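(* Let $f$ be an indefinite and anisotropic integral binary hermitian form over $k$, and let $C$ be the corresponding ocean. Then the quotient $C/U(f)$ is compact.
   Context: $D<0$ is a fundamental discriminant, $k=\mathbb{Q}(\sqrt D)\subset\mathbb{C}$, $A=\mathbb{Z}[\frac{D+\sqrt D}{2}]$ its ring of integers. For $z\in\mathbb{C}$, $N(z)=|z|^2$; for a non-zero ideal $I\subseteq A$, $N(I)=|A/I|$. A binary hermitian form over $k$ is $f(x,y)=aN(x)+cN(y)+\nu x\bar y+\bar\nu\bar x y$ ($a,c\in\mathbb{Q}$, $\nu\in k$) on $k^2$; it is integral if $f(A^2)\subseteq\mathbb{Z}$, indefinite if it takes both positive and negative values, anisotropic if $f(\mathbf w)\ne0$ for all non-zero $\mathbf w\in k^2$. Cusps are the elements of $\mathbb{P}^1(k)=k\cup\{\infty\}$; writing $\alpha=a/b$ with $a,b\in A$ not both zero ($\infty=1/0$), put $F(\alpha)=f(a,b)/N(aA+bA)$ (independent of choices). In $\mathbb{H}^3=\{(z,\zeta):z\in\mathbb{C},\zeta>0\}$, for $\alpha=a/b\in k$ ($b\ne0$) let $d_\alpha(z,\zeta)=\frac{N(b)}{N(aA+bA)}\cdot\frac{|z-\alpha|^2+\zeta^2}{\zeta}$, and $d_\infty(z,\zeta)=1/\zeta$; let $H_\alpha=\{w: d_\alpha(w)\le d_\beta(w)\ \forall\beta\}$. The spine is $X=\bigcup_{\alpha\ne\beta}H_\alpha\cap H_\beta$, whose 2-cells are the two-dimensional sets $\sigma_{\alpha,\beta}=H_\alpha\cap H_\beta$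 ($\alpha\neq\beta$). The ocean of $f$ is the union $C$ of all 2-cells $\sigma_{\alpha,\beta}$ with $F(\alpha)F(\beta)<0$. $\mathrm{GL}_2(A)$ acts on $\mathbb{H}^3$ via Poincaré extensions of Möbius transformations, with $gH_\alpha=H_{g\alpha}$ (cusp $a/b$ corresponding to the column vector $(a,b)^T$). $U(f)=\{g\in\mathrm{GL}_2(A): f(g\mathbf w)=f(\mathbf w)\ \forall \mathbf w\in k^2\}$; it preserves $C$. *)

theory Defs
  imports "HOL-Analysis.Analysis" "HOL-Computational_Algebra.Squarefree"
begin

definition fundamental_discriminant :: "int \<Rightarrow> bool" where
  "fundamental_discriminant D \<longleftrightarrow>
     D \<noteq> 1 \<and>
     (D mod 4 = 1 \<and> squarefree D \<or>
      4 dvd D \<and> (D div 4) mod 4 \<in> {2, 3} \<and> squarefree (D div 4))"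

definition quad_field :: "int \<Rightarrow> complex set" where
  "quad_field D = {of_rat p + of_rat q * csqrt (of_int D) | p q. True}"

text \<open>
  The generator is an algebraic integer of degree 2, so the ring it generates over
  the integers is spanned additively by 1 and the generator.
\<close>

definition quad_int_ring :: "int \<Rightarrow> complex set" where
  "quad_int_ring D = {of_int m + of_int n * ((of_int D + csqrt (of_int D)) / 2) | m n. True}"

definition cnorm2 :: "complex \<Rightarrow> real" where
  "cnorm2 z = (cmod z)\<^sup>2"

definition ideal2 :: "int \<Rightarrow> complex \<Rightarrow> complex \<Rightarrow> complex set" where
  "ideal2 D a b = {a * x + b * y | x y. x \<in> quad_int_ring D \<and> y \<in> quad_int_ring D}"

definition ideal_norm :: "int \<Rightarrow> complex set \<Rightarrow> nat" where
  "ideal_norm D I =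
     card (quad_int_ring D //
       {(x, y). x \<in> quad_int_ring D \<and> y \<in> quad_int_ring D \<and> x - y \<in> I})"


section \<open>Binary hermitian forms\<close>

definition quad_plane :: "int \<Rightarrow> (complex^2) set" where
  "quad_plane D = {w. \<forall>i. w $ i \<in> quad_field D}"

definition int_lattice :: "int \<Rightarrow> (complex^2) set" where
  "int_lattice D = {w. \<forall>i. w $ i \<in> quad_int_ring D}"

text \<open>
  A form is a function whose values matter only on the plane over the quadratic field;
  every notion below evaluates it only there.
\<close>

definition binary_hermitian_form :: "int \<Rightarrow> (complex^2 \<Rightarrow> real) \<Rightarrow> bool" where
  "binary_hermitian_form D f \<longleftrightarrow>
     (\<exists>(a::rat) (c::rat). \<exists>\<nu>\<in>quad_field D. \<forall>w\<in>quad_plane D.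
        complex_of_real (f w) =
          of_rat a * of_real (cnorm2 (w $ 1)) + of_rat c * of_real (cnorm2 (w $ 2))
          + \<nu> * w $ 1 * cnj (w $ 2) + cnj \<nu> * cnj (w $ 1) * w $ 2)"

definition integral_form :: "int \<Rightarrow> (complex^2 \<Rightarrow> real) \<Rightarrow> bool" where
  "integral_form D f \<longleftrightarrow> f ` int_lattice D \<subseteq> \<int>"

definition indefinite_form :: "int \<Rightarrow> (complex^2 \<Rightarrow> real) \<Rightarrow> bool" where
  "indefinite_form D f \<longleftrightarrow> (\<exists>w\<in>quad_plane D. f w > 0) \<and> (\<exists>w\<in>quad_plane D. f w < 0)"

definition anisotropic_form :: "int \<Rightarrow> (complex^2 \<Rightarrow> real) \<Rightarrow> bool" where
  "anisotropic_form D f \<longleftrightarrow> (\<forall>w\<in>quad_plane D. w \<noteq> 0 \<longrightarrow> f w \<noteq> 0)"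


section \<open>Cusps\<close>

datatype cusp = Infty | Fin complex

definition cusps :: "int \<Rightarrow> cusp set" where
  "cusps D = insert Infty (Fin ` quad_field D)"

definition cusp_of :: "complex^2 \<Rightarrow> cusp" where
  "cusp_of w = (if w $ 2 = 0 then Infty else Fin (w $ 1 / w $ 2))"

text \<open>
  An arbitrary integral representative of a cusp. The quantities derived from it below
  do not depend on the choice, since scaling a representative by \<open>x\<close> multiplies both
  numerator and denominator by \<open>cnorm2 x\<close>.
\<close>

definition cusp_rep :: "int \<Rightarrow> cusp \<Rightarrow> complex^2" where
  "cusp_rep D \<alpha> = (SOME w. w \<in> int_lattice D \<and> w \<noteq> 0 \<and> cusp_of w = \<alpha>)"

definition cusp_ideal_norm :: "int \<Rightarrow> cusp \<Rightarrow> real" where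
  "cusp_ideal_norm D \<alpha> = real (ideal_norm D (ideal2 D (cusp_rep D \<alpha> $ 1) (cusp_rep D \<alpha> $ 2)))"

definition cusp_value :: "int \<Rightarrow> (complex^2 \<Rightarrow> real) \<Rightarrow> cusp \<Rightarrow> real" where
  "cusp_value D f \<alpha> = f (cusp_rep D \<alpha>) / cusp_ideal_norm D \<alpha>"

lemma cusp_rep:
  assumes "\<alpha> \<in> cusps D"
  shows "cusp_rep D \<alpha> \<in> int_lattice D \<and> cusp_rep D \<alpha> \<noteq> 0 \<and> cusp_of (cusp_rep D \<alpha>) = \<alpha>"
proof -
  have int_in: "of_int m \<in> quad_int_ring D" for m
    unfolding quad_int_ring_def by (rule CollectI, rule exI[of _ m], rule exI[of _ 0]) simp
  have "\<exists>w. w \<in> int_lattice D \<and> w \<noteq> 0 \<and> cusp_of w = \<alpha>"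
  proof (cases \<alpha>)
    case Infty
    have "vector [1, 0] \<in> int_lattice D"
      using int_in[of 1] int_in[of 0] by (auto simp: int_lattice_def forall_2)
    moreover have "(vector [1, 0] :: complex^2) \<noteq> 0"
      by (simp add: vec_eq_iff forall_2)
    ultimately show ?thesis
      using Infty by (intro exI[of _ "vector [1, 0]"]) (simp add: cusp_of_def)
  next
    case (Fin z)
    then obtain p q where z: "z = of_rat p + of_rat q * csqrt (of_int D)"
      using assms by (auto simp: cusps_def quad_field_def)
    obtain m n where p: "p = of_int m / of_int n" and n: "n > 0"
      by (metis quotient_of_denom_pos' quotient_of_div surj_pair snd_conv)
    obtain r s where q: "q = of_int r / of_int s" and s: "s > 0"
      by (metis quotient_of_denom_pos' quotient_of_div surj_pair snd_conv)
    let ?w = "vector [z * of_int (n * s), of_int (n * s)] :: complex^2"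
    have "z * of_int (n * s) = of_int (m * s - n * r * D)
            + of_int (2 * n * r) * ((of_int D + csqrt (of_int D)) / 2)"
      using n s by (simp add: z p q of_rat_divide field_simps)
    then have "z * of_int (n * s) \<in> quad_int_ring D"
      unfolding quad_int_ring_def by blast
    with int_in have "?w \<in> int_lattice D"
      by (simp add: int_lattice_def forall_2 del: of_int_mult)
    moreover have "?w \<noteq> 0"
      using n s by (simp add: vec_eq_iff forall_2)
    moreover have "cusp_of ?w = \<alpha>"
      using n s Fin by (simp add: cusp_of_def)
    ultimately show ?thesis by blast
  qed
  then show ?thesis
    unfolding cusp_rep_def by (rule someI_ex)
qed


section \<open>The spine of hyperbolic 3-space and the ocean\<close>

definition hyp3 :: "(complex \<times> real) set" where
  "hyp3 = {(z, \<zeta>). \<zeta> > 0}"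

fun cusp_dist :: "int \<Rightarrow> cusp \<Rightarrow> complex \<times> real \<Rightarrow> real" where
  "cusp_dist D Infty (z, \<zeta>) = 1 / \<zeta>"
| "cusp_dist D (Fin \<alpha>) (z, \<zeta>) =
     cnorm2 (cusp_rep D (Fin \<alpha>) $ 2) / cusp_ideal_norm D (Fin \<alpha>)
     * (((cmod (z - \<alpha>))\<^sup>2 + \<zeta>\<^sup>2) / \<zeta>)"

definition cusp_region :: "int \<Rightarrow> cusp \<Rightarrow> (complex \<times> real) set" where
  "cusp_region D \<alpha> = {w \<in> hyp3. \<forall>\<beta>\<in>cusps D. cusp_dist D \<alpha> w \<le> cusp_dist D \<beta> w}"

definition spine_cell :: "int \<Rightarrow> cusp \<Rightarrow> cusp \<Rightarrow> (complex \<times> real) set" where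
  "spine_cell D \<alpha> \<beta> = cusp_region D \<alpha> \<inter> cusp_region D \<beta>"

text \<open>Dimension is small inductive dimension.\<close>

definition two_dimensional :: "'a::topological_space set \<Rightarrow> bool" where
  "two_dimensional S \<longleftrightarrow> top_of_set S dim_le 2 \<and> \<not> top_of_set S dim_le 1"

definition ocean :: "int \<Rightarrow> (complex^2 \<Rightarrow> real) \<Rightarrow> (complex \<times> real) set" where
  "ocean D f = \<Union> {spine_cell D \<alpha> \<beta> | \<alpha> \<beta>.
     \<alpha> \<in> cusps D \<and> \<beta> \<in> cusps D \<and> \<alpha> \<noteq> \<beta> \<and> two_dimensional (spine_cell D \<alpha> \<beta>) \<and>
     cusp_value D f \<alpha> * cusp_value D f \<beta> < 0}"


section \<open>The unitary group and its action\<close>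

definition int_matrices :: "int \<Rightarrow> (complex^2^2) set" where
  "int_matrices D = {g. \<forall>i j. g $ i $ j \<in> quad_int_ring D}"

definition GL2 :: "int \<Rightarrow> (complex^2^2) set" where
  "GL2 D = {g \<in> int_matrices D. \<exists>h\<in>int_matrices D. g ** h = mat 1 \<and> h ** g = mat 1}"

text \<open>
  The Poincare extension of \<open>z \<mapsto> (a z + b) / (c z + d)\<close> to upper half-space.
\<close>

definition poincare_ext :: "complex^2^2 \<Rightarrow> complex \<times> real \<Rightarrow> complex \<times> real" where
  "poincare_ext g w =
     (let a = g $ 1 $ 1; b = g $ 1 $ 2; c = g $ 2 $ 1; d = g $ 2 $ 2;
          z = fst w; \<zeta> = snd w;
          q = (cmod (c * z + d))\<^sup>2 + (cmod c)\<^sup>2 * \<zeta>\<^sup>2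
      in (((a * z + b) * cnj (c * z + d) + a * cnj c * of_real (\<zeta>\<^sup>2)) / of_real q,
          cmod (det g) * \<zeta> / q))"

definition unitary_group :: "int \<Rightarrow> (complex^2 \<Rightarrow> real) \<Rightarrow> (complex^2^2) set" where
  "unitary_group D f = {g \<in> GL2 D. \<forall>w\<in>quad_plane D. f (g *v w) = f w}"

definition unitary_orbit ::
  "int \<Rightarrow> (complex^2 \<Rightarrow> real) \<Rightarrow> complex \<times> real \<Rightarrow> (complex \<times> real) set" where
  "unitary_orbit D f w = (\<lambda>g. poincare_ext g w) ` unitary_group D f"

definition quotient_topology :: "'a topology \<Rightarrow> ('a \<Rightarrow> 'b) \<Rightarrow> 'b topology" where
  "quotient_topology X p =
     topology (\<lambda>V. V \<subseteq> p ` topspace X \<and> openin X {x \<in> topspace X. p x \<in> V})"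

lemma openin_quotient_topology:
  "openin (quotient_topology X p) V \<longleftrightarrow>
     V \<subseteq> p ` topspace X \<and> openin X {x \<in> topspace X. p x \<in> V}"
proof -
  have "istopology (\<lambda>V. V \<subseteq> p ` topspace X \<and> openin X {x \<in> topspace X. p x \<in> V})"
    unfolding istopology_def
  proof (intro conjI allI impI)
    fix S T
    assume S: "S \<subseteq> p ` topspace X \<and> openin X {x \<in> topspace X. p x \<in> S}"
      and T: "T \<subseteq> p ` topspace X \<and> openin X {x \<in> topspace X. p x \<in> T}"
    show "S \<inter> T \<subseteq> p ` topspace X" using S by blast
    have "{x \<in> topspace X. p x \<in> S \<inter> T} =
        {x \<in> topspace X. p x \<in> S} \<inter> {x \<in> topspace X. p x \<in> T}" by blast
    then show "openin X {x \<in> topspace X. p x \<in> S \<inter> T}" using S T by auto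
  next
    fix K
    assume K: "\<forall>V\<in>K. V \<subseteq> p ` topspace X \<and> openin X {x \<in> topspace X. p x \<in> V}"
    show "\<Union> K \<subseteq> p ` topspace X" using K by blast
    have "{x \<in> topspace X. p x \<in> \<Union> K} = \<Union> ((\<lambda>V. {x \<in> topspace X. p x \<in> V}) ` K)" by blast
    then show "openin X {x \<in> topspace X. p x \<in> \<Union> K}" using K by auto
  qed
  then show ?thesis
    by (simp add: quotient_topology_def)
qed

lemma quotient_map_quotient_topology: "quotient_map X (quotient_topology X p) p"
proof -
  have "topspace (quotient_topology X p) = p ` topspace X"
  proof
    show "topspace (quotient_topology X p) \<subseteq> p ` topspace X"
      using openin_topspace openin_quotient_topology by metis
    have "{x \<in> topspace X. p x \<in> p ` topspace X} = topspace X" by blast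
    then show "p ` topspace X \<subseteq> topspace (quotient_topology X p)"
      by (intro openin_subset) (simp add: openin_quotient_topology)
  qed
  then show ?thesis
    by (auto simp: quotient_map_def openin_quotient_topology)
qed

text \<open>
  The unitary group preserves the ocean, so the points of the quotient are exactly
  the full orbits of points of the ocean.
\<close>

definition ocean_quotient :: "int \<Rightarrow> (complex^2 \<Rightarrow> real) \<Rightarrow> (complex \<times> real) set topology" where
  "ocean_quotient D f = quotient_topology (top_of_set (ocean D f)) (unitary_orbit D f)"

end

theory Submission
  imports Defs
begin

text \<open>
  A point \<open>w = (z, \<zeta>)\<close> corresponds to the positive definite hermitian form
  \<open>P\<^sub>w(a, b) = (|a - b z|\<^sup>2 + |b|\<^sup>2 \<zeta>\<^sup>2) / \<zeta>\<close>, and \<open>d\<^sub>\<alpha>(w) = P\<^sub>w(u) / N(I\<^sub>u)\<close>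
  for any representative \<open>u\<close> of \<open>\<alpha>\<close> with content ideal \<open>I\<^sub>u\<close>.  By Dirichlet approximation
  the minimum of \<open>d\<^sub>\<alpha>(w)\<close> over all cusps is bounded independently of \<open>w\<close>, and every cusp has
  a representative of bounded content norm.  If \<open>w\<close> lies in the cell of \<open>u, v\<close>, then
  Hadamard's inequality bounds \<open>\<delta> = det (u | v)\<close>, and \<open>f(u) f(v) < 0\<close> turns the identity
  \<open>f(u) f(v) - |H(u, v)|\<^sup>2 = disc \<cdot> |\<delta>|\<^sup>2\<close> into a bound for \<open>f(u)\<close>, \<open>f(v)\<close> (non-zero integers)
  and \<open>H(u, v)\<close>.  So the Gram matrix, \<open>\<delta>\<close> and the residues of \<open>u, v\<close> modulo \<open>|\<delta>|\<^sup>2\<close> take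
  finitely many values, and two pairs with equal data differ by an element of \<open>U(f)\<close>.
  Hence finitely many cells, each of them compact, meet all orbits in the ocean.
\<close>

section \<open>Positive definite forms attached to points, and the Poincare extension\<close>

definition height_form :: "complex \<times> real \<Rightarrow> complex^2 \<Rightarrow> real" where
  "height_form w u = ((cmod (u $ 1 - u $ 2 * fst w))\<^sup>2 + (cmod (u $ 2))\<^sup>2 * (snd w)\<^sup>2) / snd w"

lemma height_form_scale: "height_form w (x *s u) = (cmod x)\<^sup>2 * height_form w u"
proof -
  have "x * u $ 1 - x * u $ 2 * fst w = x * (u $ 1 - u $ 2 * fst w)" by (simp add: algebra_simps)
  then have "(cmod (x * u $ 1 - x * u $ 2 * fst w))\<^sup>2 = (cmod x)\<^sup>2 * (cmod (u $ 1 - u $ 2 * fst w))\<^sup>2"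
    by (simp only: norm_mult power_mult_distrib)
  then show ?thesis
    by (simp add: height_form_def norm_mult power_mult_distrib distrib_left)
qed

lemma height_form_nonneg: "w \<in> hyp3 \<Longrightarrow> height_form w u \<ge> 0"
  by (auto simp: height_form_def hyp3_def)

text \<open>Hadamard's inequality. In the coordinates \<open>(a - b z) / sqrt \<zeta>\<close> and
  \<open>b * sqrt \<zeta>\<close>, a change of basis of determinant one,
  \<open>height_form w\<close> is the standard hermitian norm, and a determinant is at most the
  product of the lengths of its columns.\<close>

lemma det_le_height:
  assumes "w \<in> hyp3"
  shows "(cmod (u $ 1 * v $ 2 - v $ 1 * u $ 2))\<^sup>2 \<le> height_form w u * height_form w v"
proof -
  obtain z \<zeta> where w: "w = (z, \<zeta>)" and \<zeta>: "\<zeta> > 0" using assms by (auto simp: hyp3_def)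
  define p q r s where "p = cmod (u $ 1 - u $ 2 * z)" and "q = cmod (u $ 2) * \<zeta>"
    and "r = cmod (v $ 1 - v $ 2 * z)" and "s = cmod (v $ 2) * \<zeta>"
  have "u $ 1 * v $ 2 - v $ 1 * u $ 2 = (u $ 1 - u $ 2 * z) * v $ 2 - (v $ 1 - v $ 2 * z) * u $ 2"
    by (simp add: algebra_simps)
  also have "cmod \<dots> \<le> p * cmod (v $ 2) + r * cmod (u $ 2)"
    using norm_triangle_ineq4[of "(u $ 1 - u $ 2 * z) * v $ 2" "(v $ 1 - v $ 2 * z) * u $ 2"]
    by (simp add: norm_mult p_def r_def)
  finally have "\<zeta> * cmod (u $ 1 * v $ 2 - v $ 1 * u $ 2) \<le> \<zeta> * (p * cmod (v $ 2) + r * cmod (u $ 2))"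
    using \<zeta> by (simp add: mult_left_mono)
  also have "\<dots> = p * s + r * q" by (simp add: q_def s_def algebra_simps)
  finally have "(\<zeta> * cmod (u $ 1 * v $ 2 - v $ 1 * u $ 2))\<^sup>2 \<le> (p * s + r * q)\<^sup>2"
    using \<zeta> by (intro power_mono) auto
  \<comment> \<open>The added square completes the two-square identity for the product of
    sums.\<close>
  also have "\<dots> \<le> (p * s + r * q)\<^sup>2 + (p * r - q * s)\<^sup>2" by simp
  also have "\<dots> = (p\<^sup>2 + q\<^sup>2) * (r\<^sup>2 + s\<^sup>2)" by (simp add: power2_eq_square algebra_simps)
  finally have "(cmod (u $ 1 * v $ 2 - v $ 1 * u $ 2))\<^sup>2 * \<zeta>\<^sup>2 \<le> (p\<^sup>2 + q\<^sup>2) * (r\<^sup>2 + s\<^sup>2)"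
    by (simp add: power_mult_distrib mult.commute)
  moreover have "height_form w u * height_form w v = (p\<^sup>2 + q\<^sup>2) * (r\<^sup>2 + s\<^sup>2) / \<zeta>\<^sup>2"
    by (simp add: height_form_def w p_def q_def r_def s_def power_mult_distrib flip: power2_eq_square)
  ultimately show ?thesis using \<zeta> by (simp add: pos_le_divide_eq)
qed

text \<open>The matrix with rows \<open>(cnj r, cnj s)\<close> and \<open>(s, - r)\<close> has
  orthogonal rows of equal length, so it is a scalar multiple of a unitary matrix.\<close>

lemma lagrange_identity:
  fixes r s x y :: complex
  shows "(cmod (cnj r * x + cnj s * y))\<^sup>2 + (cmod (s * x - r * y))\<^sup>2
    = ((cmod r)\<^sup>2 + (cmod s)\<^sup>2) * ((cmod x)\<^sup>2 + (cmod y)\<^sup>2)"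
  unfolding cmod_power2 by (simp add: power2_eq_square algebra_simps)

lemma poincare_denominator_pos:
  fixes g :: "complex^2^2"
  assumes "det g \<noteq> 0" "w \<in> hyp3"
  shows "(cmod (g $ 2 $ 1 * fst w + g $ 2 $ 2))\<^sup>2 + (cmod (g $ 2 $ 1))\<^sup>2 * (snd w)\<^sup>2 > 0"
proof (cases "g $ 2 $ 1 = 0")
  case True
  then have "g $ 2 $ 2 \<noteq> 0" using assms(1) by (auto simp: det_2)
  with True show ?thesis by simp
next
  case False
  then show ?thesis using assms(2) by (intro add_nonneg_pos) (auto simp: hyp3_def)
qed

lemma poincare_ext_hyp3:
  assumes "det g \<noteq> 0" "w \<in> hyp3"
  shows "poincare_ext g w \<in> hyp3"
  using poincare_denominator_pos[OF assms] assms
  by (auto simp: poincare_ext_def hyp3_def Let_def)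

text \<open>The Poincare extension is the action of matrices on positive definite forms:
  transporting the form of \<open>w\<close> by \<open>g\<close> gives the form of the image point up
  to the scalar \<open>cmod (det g)\<close>, which keeps its determinant equal to one.\<close>

lemma height_form_poincare_ext:
  assumes "det g \<noteq> 0" "w \<in> hyp3"
  shows "height_form (poincare_ext g w) (g *v u) = cmod (det g) * height_form w u"
proof -
  define a b c d where abcd: "a = g $ 1 $ 1" "b = g $ 1 $ 2" "c = g $ 2 $ 1" "d = g $ 2 $ 2"
  define \<delta> where "\<delta> = a * d - b * c"
  have det: "det g = \<delta>" by (simp add: \<delta>_def abcd det_2)
  obtain z \<zeta> where w: "w = (z, \<zeta>)" and \<zeta>: "\<zeta> > 0" using assms(2) by (auto simp: hyp3_def)
  define r where "r = c * z + d"
  define q where "q = (cmod r)\<^sup>2 + (cmod (c * of_real \<zeta>))\<^sup>2"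
  define z' where "z' = ((a * z + b) * cnj r + a * cnj c * of_real (\<zeta>\<^sup>2)) / of_real q"
  have q: "q > 0"
    using poincare_denominator_pos[OF assms] by (simp add: q_def r_def abcd w norm_mult power_mult_distrib)
  have pe: "poincare_ext g w = (z', cmod \<delta> * \<zeta> / q)"
    by (simp add: poincare_ext_def Let_def z'_def q_def r_def abcd w det norm_mult power_mult_distrib)
  define x y where "x = a * u $ 1 + b * u $ 2" and "y = c * u $ 1 + d * u $ 2"
  have gu: "(g *v u) $ 1 = x" "(g *v u) $ 2 = y"
    by (simp_all add: matrix_vector_mult_def sum_2 x_def y_def abcd)
  \<comment> \<open>Up to the factor \<open>\<delta>\<close> and a sign these are the two
    coordinates of \<open>u\<close> at the point \<open>w\<close>. The matrix of
    \<open>lagrange_identity\<close> turns them into the coordinates of \<open>g *v u\<close> at the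
    image point, up to the factor \<open>q\<close> and a phase.\<close>
  define X Y where "X = \<delta> * (u $ 1 - u $ 2 * z)" and "Y = - \<delta> * u $ 2 * of_real \<zeta>"
  have qc: "of_real q = r * cnj r + c * cnj c * of_real \<zeta> * of_real \<zeta>"
    by (simp add: q_def complex_norm_square mult_ac del: of_real_power)
  have "of_real q * (x - y * z') = of_real q * x - y * ((a * z + b) * cnj r + a * cnj c * of_real (\<zeta>\<^sup>2))"
    using q by (simp add: z'_def field_simps)
  also have "\<dots> = cnj r * X + cnj (c * of_real \<zeta>) * Y"
    unfolding qc by (simp add: x_def y_def X_def Y_def \<delta>_def r_def power2_eq_square algebra_simps)
  finally have 1: "of_real q * (x - y * z') = cnj r * X + cnj (c * of_real \<zeta>) * Y" .
  have 2: "(c * of_real \<zeta>) * X - r * Y = of_real \<zeta> * \<delta> * y"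
    by (simp add: x_def y_def X_def Y_def \<delta>_def r_def algebra_simps)
  have "(cmod (of_real q * (x - y * z')))\<^sup>2 + (cmod (of_real \<zeta> * \<delta> * y))\<^sup>2
      = q * ((cmod X)\<^sup>2 + (cmod Y)\<^sup>2)"
    using lagrange_identity[of r X "c * of_real \<zeta>" Y] unfolding 1 2 by (simp add: q_def)
  also have "(cmod X)\<^sup>2 + (cmod Y)\<^sup>2 = (cmod \<delta>)\<^sup>2 * (\<zeta> * height_form w u)"
  proof -
    have "\<zeta> * height_form w u = (cmod (u $ 1 - u $ 2 * z))\<^sup>2 + (cmod (u $ 2))\<^sup>2 * \<zeta>\<^sup>2"
      using \<zeta> by (simp add: height_form_def w)
    then show ?thesis by (simp add: X_def Y_def norm_mult power_mult_distrib distrib_left)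
  qed
  finally have "q\<^sup>2 * (cmod (x - y * z'))\<^sup>2 + \<zeta>\<^sup>2 * (cmod \<delta>)\<^sup>2 * (cmod y)\<^sup>2
      = q * ((cmod \<delta>)\<^sup>2 * (\<zeta> * height_form w u))"
    by (simp add: norm_mult power_mult_distrib)
  then have "(cmod (x - y * z'))\<^sup>2 + (cmod y)\<^sup>2 * (cmod \<delta> * \<zeta> / q)\<^sup>2
      = (cmod \<delta>)\<^sup>2 * (\<zeta> * height_form w u) / q"
    using q by (simp add: field_simps power2_eq_square)
  then have "height_form (poincare_ext g w) (g *v u)
      = ((cmod \<delta>)\<^sup>2 * (\<zeta> * height_form w u) / q) / (cmod \<delta> * \<zeta> / q)"
    by (simp add: height_form_def pe gu)
  also have "\<dots> = cmod \<delta> * height_form w u"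
    using q \<zeta> assms(1) det by (simp add: power2_eq_square)
  finally show ?thesis by (simp add: det)
qed

text \<open>The value at \<open>(1, 0)\<close> is \<open>1 / \<zeta>\<close>. Once the heights
  agree, the excess of the value at \<open>(z, 1)\<close> measures the distance between the two base
  points.\<close>

lemma height_form_inject:
  assumes "w \<in> hyp3" "w' \<in> hyp3" "\<And>u. height_form w u = height_form w' u"
  shows "w = w'"
proof -
  obtain z \<zeta> z' \<zeta>' where w: "w = (z, \<zeta>)" "w' = (z', \<zeta>')" and \<zeta>: "\<zeta> > 0" "\<zeta>' > 0"
    using assms(1,2) by (auto simp: hyp3_def)
  have "\<zeta> = \<zeta>'" using assms(3)[of "vector [1, 0]"] by (simp add: height_form_def w)
  moreover have "z = z'"
    using assms(3)[of "vector [z, 1]"] \<zeta> by (simp add: height_form_def w \<open>\<zeta> = \<zeta>'\<close>)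
  ultimately show ?thesis by (simp add: w)
qed

text \<open>Composing the explicit formulas is avoided: both points carry the form of
  \<open>w\<close> transported by \<open>h ** g\<close>, and a form determines its point.\<close>

lemma poincare_ext_mult:
  assumes g: "det g \<noteq> 0" and h: "det h \<noteq> 0" and w: "w \<in> hyp3"
  shows "poincare_ext (h ** g) w = poincare_ext h (poincare_ext g w)"
proof (rule height_form_inject)
  have hg: "det (h ** g) \<noteq> 0" using g h by (simp add: det_mul)
  show "poincare_ext (h ** g) w \<in> hyp3" "poincare_ext h (poincare_ext g w) \<in> hyp3"
    using poincare_ext_hyp3 g h hg w by auto
  fix v
  obtain k where "(h ** g) ** k = mat 1" using hg by (metis invertible_def invertible_det_nz)
  then have v: "v = (h ** g) *v (k *v v)" by (simp add: matrix_vector_mul_assoc)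
  have "height_form (poincare_ext (h ** g) w) ((h ** g) *v u)
      = height_form (poincare_ext h (poincare_ext g w)) ((h ** g) *v u)" for u
    using height_form_poincare_ext[OF hg w] height_form_poincare_ext[OF h poincare_ext_hyp3[OF g w]]
      height_form_poincare_ext[OF g w]
    by (simp add: det_mul norm_mult flip: matrix_vector_mul_assoc)
  then show "height_form (poincare_ext (h ** g) w) v
      = height_form (poincare_ext h (poincare_ext g w)) v"
    using v by metis
qed

lemma poincare_ext_one: "poincare_ext (mat 1) w = w"
  by (simp add: poincare_ext_def Let_def det_2) (simp add: mat_def)

lemma cusp_of_scale: "x \<noteq> 0 \<Longrightarrow> cusp_of (x *s u) = cusp_of u"
  by (simp add: cusp_of_def)

definition minor :: "(complex^2) \<times> (complex^2) \<Rightarrow> complex" where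
  "minor = (\<lambda>(u, v). u $ 1 * v $ 2 - v $ 1 * u $ 2)"

lemma matrix_left_inverse_vector:
  assumes "h ** g = mat 1"
  shows "h *v (g *v u) = (u :: complex^2)"
  by (simp add: matrix_vector_mul_assoc assms)

section \<open>The sesquilinear form behind a binary hermitian form\<close>

definition herm :: "real \<Rightarrow> real \<Rightarrow> complex \<Rightarrow> complex^2 \<Rightarrow> complex^2 \<Rightarrow> complex" where
  "herm a c \<nu> x y = of_real a * x $ 1 * cnj (y $ 1) + of_real c * x $ 2 * cnj (y $ 2)
     + \<nu> * x $ 1 * cnj (y $ 2) + cnj \<nu> * x $ 2 * cnj (y $ 1)"

lemma herm_sym: "herm a c \<nu> y x = cnj (herm a c \<nu> x y)"
  by (simp add: herm_def algebra_simps)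

text \<open>The Gram matrix of \<open>u\<close>, \<open>v\<close> is the matrix of the form
  multiplied on its two sides by the matrix of \<open>u\<close>, \<open>v\<close> and its adjoint,
  up to transposition, so the determinants multiply.\<close>

lemma herm_gram:
  "herm a c \<nu> u u * herm a c \<nu> v v - herm a c \<nu> u v * herm a c \<nu> v u
    = (of_real (a * c) - \<nu> * cnj \<nu>) * (u $ 1 * v $ 2 - v $ 1 * u $ 2) * cnj (u $ 1 * v $ 2 - v $ 1 * u $ 2)"
  by (simp add: herm_def algebra_simps)

lemma herm_combination:
  "herm a c \<nu> (p *s u + q *s v) (p *s u + q *s v)
    = p * cnj p * herm a c \<nu> u u + p * cnj q * herm a c \<nu> u v
      + q * cnj p * herm a c \<nu> v u + q * cnj q * herm a c \<nu> v v"
  by (simp add: herm_def algebra_simps)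

section \<open>Arithmetic of the imaginary quadratic order\<close>

locale imag_quadratic =
  fixes D :: int
  assumes D_neg: "D < 0" and D_mod_4: "D mod 4 = 0 \<or> D mod 4 = 1"
begin

definition \<omega> :: complex where
  "\<omega> = (of_int D + csqrt (of_int D)) / 2"

definition ring_elt :: "int \<Rightarrow> int \<Rightarrow> complex" where
  "ring_elt m n = of_int m + of_int n * \<omega>"

abbreviation A :: "complex set" where
  "A \<equiv> quad_int_ring D"

lemma csqrt_D: "csqrt (of_int D) = \<i> * of_real (sqrt (- of_int D))"
  using D_neg csqrt_of_real_nonpos[of "of_int D"] by (simp add: complex_eq_iff)

lemma Re_\<omega>: "Re \<omega> = of_int D / 2" and Im_\<omega>: "Im \<omega> = sqrt (- of_int D) / 2"
  by (simp_all add: \<omega>_def csqrt_D)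

lemma Im_\<omega>_pos: "Im \<omega> > 0"
  using D_neg by (simp add: Im_\<omega>)

lemma cnj_\<omega>: "cnj \<omega> = of_int D - \<omega>"
  by (simp add: complex_eq_iff Re_\<omega> Im_\<omega>)

lemma A_eq: "A = {ring_elt m n | m n. True}"
  by (simp add: quad_int_ring_def ring_elt_def \<omega>_def)

lemma ring_elt_in_A [simp]: "ring_elt m n \<in> A"
  by (auto simp: A_eq)

lemma A_E:
  assumes "x \<in> A"
  obtains m n where "x = ring_elt m n"
  using assms by (auto simp: A_eq)

lemma ring_elt_inject [simp]: "ring_elt m n = ring_elt m' n' \<longleftrightarrow> m = m' \<and> n = n'"
proof
  assume eq: "ring_elt m n = ring_elt m' n'"
  then have "Im (ring_elt m n) = Im (ring_elt m' n')" by simp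
  then have "n = n'" using Im_\<omega>_pos by (simp add: ring_elt_def)
  with eq show "m = m' \<and> n = n'" by (simp add: ring_elt_def)
qed simp

text \<open>\<omega> is a root of \<open>x^2 - D x + (D^2 - D) / 4\<close>. The congruence of
  \<open>D\<close> modulo 4 makes the constant term integral, so that the span of 1 and \<omega> is
  closed under multiplication.\<close>

lemma \<omega>_square: "\<omega> * \<omega> = of_int D * \<omega> - of_int ((D * D - D) div 4)"
proof -
  have "4 dvd D * (D - 1)"
    using D_mod_4 mod_eq_dvd_iff[of D 4 1] by (auto simp: mod_eq_0_iff_dvd)
  then have "4 dvd D * D - D"
    by (simp add: right_diff_distrib)
  then have 4: "real_of_int ((D * D - D) div 4) = (of_int D * of_int D - of_int D) / 4"
    by (subst real_of_int_div) auto
  have "sqrt (- of_int D) * sqrt (- of_int D) = - of_int D"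
    using D_neg by simp
  then show ?thesis
    by (simp add: complex_eq_iff 4 Re_\<omega> Im_\<omega> field_simps)
qed

lemma of_int_in_A [simp]: "of_int m \<in> A"
  using ring_elt_in_A[of m 0] by (simp add: ring_elt_def)

lemma of_nat_in_A [simp]: "of_nat m \<in> A"
  using of_int_in_A[of "int m"] by simp

lemma zero_in_A [simp]: "0 \<in> A" and one_in_A [simp]: "1 \<in> A"
  using of_int_in_A[of 0] of_int_in_A[of 1] by simp_all

lemma \<omega>_in_A [simp]: "\<omega> \<in> A"
  using ring_elt_in_A[of 0 1] by (simp add: ring_elt_def)

lemma ring_elt_add: "ring_elt m n + ring_elt m' n' = ring_elt (m + m') (n + n')"
  and ring_elt_diff: "ring_elt m n - ring_elt m' n' = ring_elt (m - m') (n - n')"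
  by (simp_all add: ring_elt_def algebra_simps)

lemma add_in_A [simp]: "x \<in> A \<Longrightarrow> y \<in> A \<Longrightarrow> x + y \<in> A"
  by (elim A_E) (simp add: ring_elt_add)

lemma diff_in_A [simp]: "x \<in> A \<Longrightarrow> y \<in> A \<Longrightarrow> x - y \<in> A"
  by (elim A_E) (simp add: ring_elt_diff)

lemma uminus_in_A [simp]: "x \<in> A \<Longrightarrow> - x \<in> A"
  using diff_in_A[of 0 x] by simp

lemma mult_in_A [simp]:
  assumes "x \<in> A" "y \<in> A"
  shows "x * y \<in> A"
proof -
  obtain m n m' n' where x: "x = ring_elt m n" and y: "y = ring_elt m' n'"
    using assms by (elim A_E)
  have "x * y = of_int (m * m') + of_int (m * n' + n * m') * \<omega> + of_int (n * n') * (\<omega> * \<omega>)"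
    by (simp add: x y ring_elt_def algebra_simps)
  also have "\<dots> = ring_elt (m * m' - n * n' * ((D * D - D) div 4)) (m * n' + n * m' + n * n' * D)"
    by (simp add: \<omega>_square ring_elt_def algebra_simps)
  finally show ?thesis by simp
qed

lemma cnj_in_A [simp]:
  assumes "x \<in> A"
  shows "cnj x \<in> A"
proof -
  obtain m n where "x = ring_elt m n" using assms by (elim A_E)
  then have "cnj x = ring_elt (m + n * D) (- n)"
    by (simp add: ring_elt_def cnj_\<omega> algebra_simps)
  then show ?thesis by simp
qed

lemma real_A_in_Ints:
  assumes "of_real r \<in> A"
  shows "r \<in> \<int>"
proof -
  obtain m n where eq: "of_real r = ring_elt m n" using assms by (elim A_E)
  then have "Im (ring_elt m n) = 0" by (metis Im_complex_of_real)
  then have "n = 0" using Im_\<omega>_pos by (simp add: ring_elt_def)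
  with eq have "r = of_int m" by (simp add: ring_elt_def complex_eq_iff)
  then show ?thesis by simp
qed

text \<open>\<open>x * cnj x\<close> is a real element of \<open>A\<close>, and the real elements of
  \<open>A\<close> are integers.\<close>

lemma norm_in_Nats:
  assumes "x \<in> A"
  obtains n :: nat where "(cmod x)\<^sup>2 = real n" "x * cnj x = of_nat n"
proof -
  have "of_real ((cmod x)\<^sup>2) \<in> A"
    using mult_in_A[OF assms cnj_in_A[OF assms]] by (simp flip: complex_norm_square)
  then have "(cmod x)\<^sup>2 \<in> \<int>" by (rule real_A_in_Ints)
  then obtain n where "(cmod x)\<^sup>2 = real n"
    by (metis Ints_cases of_int_0_le_iff of_nat_nat zero_le_power2 of_int_of_nat_eq)
  moreover from this have "x * cnj x = of_nat n"
    by (metis complex_norm_square of_real_of_nat_eq)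
  ultimately show thesis by (rule that)
qed

lemma norm_ge_1:
  assumes "x \<in> A" "x \<noteq> 0"
  shows "(cmod x)\<^sup>2 \<ge> 1"
proof -
  obtain n :: nat where "(cmod x)\<^sup>2 = real n" using assms(1) by (rule norm_in_Nats)
  with assms(2) show ?thesis
    by (metis One_nat_def Suc_leI norm_eq_zero of_nat_0_eq_iff of_nat_1 of_nat_le_iff
        power_eq_0_iff zero_less_iff_neq_zero)
qed

subsection \<open>Dirichlet approximation\<close>

lemma real_coords:
  obtains s t :: real where "z = of_real s + of_real t * \<omega>"
proof
  show "z = of_real (Re z - Im z / Im \<omega> * Re \<omega>) + of_real (Im z / Im \<omega>) * \<omega>"
    using Im_\<omega>_pos by (simp add: complex_eq_iff)
qed

definition dirichlet_const :: real where
  "dirichlet_const = 1 + cmod \<omega>"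

lemma dirichlet_const_pos: "dirichlet_const > 0"
  by (simp add: dirichlet_const_def add_pos_nonneg)

lemma norm_coords_le:
  assumes "\<bar>s\<bar> \<le> B" "\<bar>t\<bar> \<le> B"
  shows "cmod (of_real s + of_real t * \<omega>) \<le> dirichlet_const * B"
proof -
  have "cmod (of_real s + of_real t * \<omega>) \<le> \<bar>s\<bar> + \<bar>t\<bar> * cmod \<omega>"
    using norm_triangle_ineq[of "of_real s" "of_real t * \<omega>"] by (simp add: norm_mult)
  also have "\<dots> \<le> B + B * cmod \<omega>"
    using assms by (intro add_mono mult_right_mono) auto
  finally show ?thesis by (simp add: dirichlet_const_def algebra_simps)
qed

text \<open>Pigeonhole. The \<open>(k + 1)^2\<close> elements with coordinates in
  \<open>0..k\<close> give multiples of \<open>z\<close> whose fractional coordinates fall into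
  \<open>k^2\<close> boxes of side \<open>1 / k\<close>. For two elements in one box,
  \<open>b\<close> is their difference and \<open>a\<close> the difference of the integer parts of
  their multiples of \<open>z\<close>.\<close>

lemma dirichlet_approximation:
  fixes z :: complex and k :: nat
  assumes "k \<ge> 1"
  obtains a b where "a \<in> A" "b \<in> A" "b \<noteq> 0" "cmod b \<le> dirichlet_const * k"
    "cmod (a - b * z) \<le> dirichlet_const / k"
proof -
  have "\<forall>p. \<exists>s t. ring_elt (int (fst p)) (int (snd p)) * z = of_real s + of_real t * \<omega>"
    by (meson real_coords)
  then obtain s t where st: "\<And>p. ring_elt (int (fst p)) (int (snd p)) * z
      = of_real (s p) + of_real (t p) * \<omega>" by metis
  define box where "box p = (\<lfloor>real k * frac (s p)\<rfloor>, \<lfloor>real k * frac (t p)\<rfloor>)" for p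
  have box_range: "\<lfloor>real k * frac x\<rfloor> \<in> {0..<int k}" for x
  proof -
    have "real k * frac x < real k" using assms frac_lt_1[of x] by simp
    moreover have "real k * frac x \<ge> 0" by simp
    ultimately show ?thesis by (simp add: floor_less_iff)
  qed
  have "card (box ` ({0..k} \<times> {0..k})) \<le> card ({0..<int k} \<times> {0..<int k})"
    using box_range by (intro card_mono) (auto simp: box_def)
  also have "\<dots> < card ({0..k} \<times> {0..k})" by (simp add: card_cartesian_product)
  finally have "\<not> inj_on box ({0..k} \<times> {0..k})" by (rule pigeonhole)
  then obtain p q where pq: "p \<in> {0..k} \<times> {0..k}" "q \<in> {0..k} \<times> {0..k}" "p \<noteq> q" "box p = box q"
    by (auto simp: inj_on_def)
  define b where "b = ring_elt (int (fst p) - int (fst q)) (int (snd p) - int (snd q))"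
  define a where "a = ring_elt (\<lfloor>s p\<rfloor> - \<lfloor>s q\<rfloor>) (\<lfloor>t p\<rfloor> - \<lfloor>t q\<rfloor>)"
  have close: "\<bar>frac x - frac y\<bar> \<le> 1 / k" if "\<lfloor>real k * frac x\<rfloor> = \<lfloor>real k * frac y\<rfloor>" for x y
  proof -
    have "\<bar>real k * frac x - real k * frac y\<bar> \<le> 1" using that by linarith
    then have "real k * \<bar>frac x - frac y\<bar> \<le> 1"
      by (simp add: abs_mult flip: right_diff_distrib)
    with assms show ?thesis by (simp add: field_simps)
  qed
  have "b * z = ring_elt (int (fst p)) (int (snd p)) * z - ring_elt (int (fst q)) (int (snd q)) * z"
    by (simp add: b_def ring_elt_diff flip: left_diff_distrib)
  then have "b * z = (of_real (s p) + of_real (t p) * \<omega>) - (of_real (s q) + of_real (t q) * \<omega>)"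
    by (simp only: st)
  then have "a - b * z = - (of_real (frac (s p) - frac (s q)) + of_real (frac (t p) - frac (t q)) * \<omega>)"
    by (simp add: a_def ring_elt_def frac_def algebra_simps)
  then have "cmod (a - b * z)
      = cmod (of_real (frac (s p) - frac (s q)) + of_real (frac (t p) - frac (t q)) * \<omega>)"
    by (simp only: norm_minus_cancel)
  also have "\<dots> \<le> dirichlet_const * (1 / k)"
    using pq(4) by (intro norm_coords_le close) (auto simp: box_def)
  finally have 1: "cmod (a - b * z) \<le> dirichlet_const / k" by simp
  have "b = of_real (real (fst p) - real (fst q)) + of_real (real (snd p) - real (snd q)) * \<omega>"
    by (simp add: b_def ring_elt_def)
  then have 2: "cmod b \<le> dirichlet_const * k"
    using pq(1,2) by (auto intro!: norm_coords_le simp del: of_real_diff)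
  have 3: "b \<noteq> 0"
  proof
    assume "b = 0"
    then have "b = ring_elt 0 0" by (simp add: ring_elt_def)
    with pq(3) show False by (simp add: b_def prod_eq_iff)
  qed
  show thesis
    by (rule that[of a b]) (use 1 2 3 in \<open>auto simp: a_def b_def\<close>)
qed

subsection \<open>Indices of ideals\<close>

definition add_subgroup :: "complex set \<Rightarrow> bool" where
  "add_subgroup I \<longleftrightarrow> I \<subseteq> A \<and> 0 \<in> I \<and> (\<forall>x\<in>I. \<forall>y\<in>I. x - y \<in> I)"

definition cong_rel :: "complex set \<Rightarrow> (complex \<times> complex) set" where
  "cong_rel I = {(x, y). x \<in> A \<and> y \<in> A \<and> x - y \<in> I}"

lemma ideal_norm_eq: "ideal_norm D I = card (A // cong_rel I)"
  by (simp add: ideal_norm_def cong_rel_def)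

lemma equiv_cong_rel:
  assumes "add_subgroup I"
  shows "equiv A (cong_rel I)"
proof -
  have neg: "- x \<in> I" if "x \<in> I" for x
    using assms that by (metis add_subgroup_def diff_0)
  have "sym (cong_rel I)"
    by (rule symI) (use neg in \<open>force simp: cong_rel_def\<close>)
  moreover have "trans (cong_rel I)"
  proof (rule transI)
    fix x y z
    assume "(x, y) \<in> cong_rel I" "(y, z) \<in> cong_rel I"
    then have *: "x \<in> A" "z \<in> A" "x - y \<in> I" "- (y - z) \<in> I"
      using neg[of "y - z"] by (auto simp: cong_rel_def)
    then have "(x - y) - (- (y - z)) \<in> I"
      using assms unfolding add_subgroup_def by blast
    with * show "(x, z) \<in> cong_rel I" by (simp add: cong_rel_def)
  qed
  moreover have "refl_on A (cong_rel I)"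
    using assms by (auto simp: refl_on_def cong_rel_def add_subgroup_def)
  ultimately show ?thesis
    by (intro equivI) (auto simp: cong_rel_def)
qed

lemma cong_class_eq_iff:
  assumes "add_subgroup I" "x \<in> A" "y \<in> A"
  shows "cong_rel I `` {x} = cong_rel I `` {y} \<longleftrightarrow> x - y \<in> I"
  using eq_equiv_class_iff[OF equiv_cong_rel[OF assms(1)] assms(2,3)] assms(2,3)
  by (simp add: cong_rel_def)

lemma cong_class_rep:
  assumes "add_subgroup I" "C \<in> A // cong_rel I"
  shows "(SOME x. x \<in> C) \<in> A" "cong_rel I `` {SOME x. x \<in> C} = C"
proof -
  obtain y where y: "y \<in> A" "C = cong_rel I `` {y}" using assms(2) by (rule quotientE)
  have "y \<in> C" using y assms(1) by (simp add: cong_rel_def add_subgroup_def)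
  then have *: "(SOME x. x \<in> C) \<in> C" by (rule someI)
  then show 1: "(SOME x. x \<in> C) \<in> A" using y by (auto simp: cong_rel_def)
  show "cong_rel I `` {SOME x. x \<in> C} = C"
    using * y equiv_class_eq[OF equiv_cong_rel[OF assms(1)]] by blast
qed

lemma add_subgroup_A: "add_subgroup A"
  by (simp add: add_subgroup_def)

lemma add_subgroup_scale:
  assumes "add_subgroup I" "x \<in> A"
  shows "add_subgroup ((*) x ` I)"
  using assms by (auto simp: add_subgroup_def image_iff simp flip: right_diff_distrib)

text \<open>\<open>[A : xI] = [A : xA] [xA : xI]\<close>, and multiplication by \<open>x\<close>
  identifies \<open>A / I\<close> with \<open>xA / xI\<close>. The bijection \<open>F\<close> is
  built from chosen representatives of the classes.\<close>

lemma ideal_norm_scale_principal: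
  assumes I: "add_subgroup I" and x: "x \<in> A" "x \<noteq> 0"
  shows "ideal_norm D ((*) x ` I) = ideal_norm D ((*) x ` A) * ideal_norm D I"
proof -
  define rep :: "complex set \<Rightarrow> complex" where "rep C = (SOME y. y \<in> C)" for C
  define F where "F = (\<lambda>(C, C'). cong_rel ((*) x ` I) `` {rep C + x * rep C'})"
  have xA: "add_subgroup ((*) x ` A)" and xI: "add_subgroup ((*) x ` I)"
    using add_subgroup_scale add_subgroup_A I x by auto
  have IA: "I \<subseteq> A" using I by (simp add: add_subgroup_def)
  note rep1 = cong_class_rep[OF xA, folded rep_def] and rep2 = cong_class_rep[OF I, folded rep_def]
  have "inj_on F ((A // cong_rel ((*) x ` A)) \<times> (A // cong_rel I))"
  proof (rule inj_onI, clarsimp simp: F_def)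
    fix C C' E E'
    assume *: "C \<in> A // cong_rel ((*) x ` A)" "E \<in> A // cong_rel ((*) x ` A)"
      "C' \<in> A // cong_rel I" "E' \<in> A // cong_rel I"
      and "cong_rel ((*) x ` I) `` {rep C + x * rep C'} = cong_rel ((*) x ` I) `` {rep E + x * rep E'}"
    then have "(rep C + x * rep C') - (rep E + x * rep E') \<in> (*) x ` I"
      using cong_class_eq_iff[OF xI] rep1 rep2 x by simp
    then obtain i where i: "i \<in> I" "rep C + x * rep C' - (rep E + x * rep E') = x * i" by blast
    then have "rep C - rep E = x * (rep E' - rep C' + i)" by (simp add: algebra_simps)
    then have "rep C - rep E \<in> (*) x ` A"
      using * i IA rep2 by (intro image_eqI[of _ _ "rep E' - rep C' + i"]) auto
    then have "C = E" using cong_class_eq_iff[OF xA] rep1 * by metis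
    with i x have "rep C' - rep E' \<in> I" by (simp flip: right_diff_distrib)
    then have "C' = E'" using cong_class_eq_iff[OF I] rep2 * by metis
    with \<open>C = E\<close> show "C = E \<and> C' = E'" ..
  qed
  moreover have "F ` ((A // cong_rel ((*) x ` A)) \<times> (A // cong_rel I)) = A // cong_rel ((*) x ` I)"
  proof (intro equalityI subsetI)
    fix Q assume "Q \<in> F ` ((A // cong_rel ((*) x ` A)) \<times> (A // cong_rel I))"
    then show "Q \<in> A // cong_rel ((*) x ` I)"
      using rep1(1) rep2(1) x by (auto simp: F_def intro!: quotientI)
  next
    fix Q assume "Q \<in> A // cong_rel ((*) x ` I)"
    then obtain a where a: "a \<in> A" "Q = cong_rel ((*) x ` I) `` {a}" by (rule quotientE)
    define C where "C = cong_rel ((*) x ` A) `` {a}"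
    have C: "C \<in> A // cong_rel ((*) x ` A)" unfolding C_def using a by (intro quotientI)
    then have "a - rep C \<in> (*) x ` A"
      using cong_class_eq_iff[OF xA a(1)] rep1[OF C] C_def by metis
    then obtain b where b: "b \<in> A" "a - rep C = x * b" by blast
    define C' where "C' = cong_rel I `` {b}"
    have C': "C' \<in> A // cong_rel I" unfolding C'_def using b by (intro quotientI)
    then have "b - rep C' \<in> I"
      using cong_class_eq_iff[OF I b(1)] rep2[OF C'] C'_def by metis
    moreover have "a - (rep C + x * rep C') = x * (b - rep C')"
      using b by (simp add: algebra_simps)
    ultimately have "a - (rep C + x * rep C') \<in> (*) x ` I" by (metis imageI)
    then have "Q = F (C, C')"
      using a cong_class_eq_iff[OF xI a(1)] rep1[OF C] rep2[OF C'] x by (simp add: F_def)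
    then show "Q \<in> F ` ((A // cong_rel ((*) x ` A)) \<times> (A // cong_rel I))" using C C' by blast
  qed
  ultimately have "bij_betw F ((A // cong_rel ((*) x ` A)) \<times> (A // cong_rel I)) (A // cong_rel ((*) x ` I))"
    by (simp add: bij_betw_def)
  from bij_betw_same_card[OF this] show ?thesis
    by (simp add: ideal_norm_eq card_cartesian_product)
qed

text \<open>In the basis 1, \<omega>, divisibility by \<open>n\<close> means divisibility of both
  coordinates, so \<open>A / nA\<close> is a copy of \<open>(Z/n)^2\<close>.\<close>

lemma bij_betw_residues:
  assumes "n > 0"
  shows "bij_betw (\<lambda>(p, q). cong_rel ((*) (of_nat n) ` A) `` {ring_elt p q})
    ({0..<int n} \<times> {0..<int n}) (A // cong_rel ((*) (of_nat n) ` A))"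
proof -
  let ?I = "(*) (of_nat n) ` A"
  have I: "add_subgroup ?I" by (simp add: add_subgroup_scale add_subgroup_A)
  have mem_iff: "ring_elt p q \<in> ?I \<longleftrightarrow> int n dvd p \<and> int n dvd q" for p q
  proof -
    have "ring_elt p q \<in> ?I \<longleftrightarrow> (\<exists>r s. ring_elt p q = of_nat n * ring_elt r s)"
      by (auto simp: A_eq)
    also have "\<dots> \<longleftrightarrow> (\<exists>r s. ring_elt p q = ring_elt (int n * r) (int n * s))"
      by (simp add: ring_elt_def algebra_simps)
    finally show ?thesis by (auto simp: dvd_def)
  qed
  have *: "cong_rel ?I `` {ring_elt p q} = cong_rel ?I `` {ring_elt r s}
      \<longleftrightarrow> p mod int n = r mod int n \<and> q mod int n = s mod int n" for p q r s
    by (simp add: cong_class_eq_iff[OF I] ring_elt_diff mem_iff mod_eq_dvd_iff)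
  show ?thesis
    unfolding bij_betw_def
  proof (intro conjI equalityI subsetI)
    show "inj_on (\<lambda>(p, q). cong_rel ?I `` {ring_elt p q}) ({0..<int n} \<times> {0..<int n})"
      by (rule inj_onI) (auto simp: *)
  next
    fix Q assume "Q \<in> A // cong_rel ?I"
    then obtain p q where "Q = cong_rel ?I `` {ring_elt p q}" by (elim quotientE A_E) simp
    then have "Q = cong_rel ?I `` {ring_elt (p mod int n) (q mod int n)}" by (simp add: *)
    then show "Q \<in> (\<lambda>(p, q). cong_rel ?I `` {ring_elt p q}) ` ({0..<int n} \<times> {0..<int n})"
      using assms by (intro image_eqI[of _ _ "(p mod int n, q mod int n)"]) auto
  qed (auto intro: quotientI)
qed

lemma finite_residues: "n > 0 \<Longrightarrow> finite (A // cong_rel ((*) (of_nat n) ` A))"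
  using bij_betw_finite[OF bij_betw_residues] by simp

lemma ideal_norm_of_nat: "n > 0 \<Longrightarrow> ideal_norm D ((*) (of_nat n) ` A) = n\<^sup>2"
  using bij_betw_same_card[OF bij_betw_residues]
  by (simp add: ideal_norm_eq card_cartesian_product power2_eq_square)

text \<open>Conjugation is an additive bijection of \<open>A\<close>, so it carries the classes
  modulo \<open>I\<close> to those modulo its conjugate.\<close>

lemma ideal_norm_cnj: "ideal_norm D (cnj ` I) = ideal_norm D I"
proof -
  have cnj_A_iff: "cnj x \<in> A \<longleftrightarrow> x \<in> A" for x
    using cnj_in_A[of x] cnj_in_A[of "cnj x"] by auto
  have mem: "y \<in> cnj ` S \<longleftrightarrow> cnj y \<in> S" for y S
    by (metis complex_cnj_cnj image_iff)
  then have cnj_A: "cnj ` A = A" using cnj_A_iff by blast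
  have cls: "cong_rel (cnj ` I) `` {cnj x} = cnj ` (cong_rel I `` {x})" if "x \<in> A" for x
    by (rule set_eqI) (simp add: mem cong_rel_def cnj_A_iff)
  have "A // cong_rel (cnj ` I) = (\<lambda>x. cong_rel (cnj ` I) `` {x}) ` (cnj ` A)"
    unfolding cnj_A by (auto simp: quotient_def)
  also have "\<dots> = (`) cnj ` (A // cong_rel I)"
    by (force simp: quotient_def cls image_iff)
  finally have eq: "A // cong_rel (cnj ` I) = (`) cnj ` (A // cong_rel I)" .
  have "inj_on ((`) cnj) (A // cong_rel I)"
    by (rule inj_onI) (metis inj_image_eq_iff injI complex_cnj_cancel_iff)
  then show ?thesis by (simp add: ideal_norm_eq eq card_image)
qed

text \<open>Put \<open>n = x * cnj x\<close>. Since \<open>nA\<close> is \<open>x\<close> times the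
  ideal generated by \<open>cnj x\<close>, the index \<open>n^2\<close> of \<open>nA\<close> is the
  product of the indices of two conjugate principal ideals, which are equal.\<close>

lemma ideal_norm_principal:
  assumes "x \<in> A" "x \<noteq> 0"
  shows "real (ideal_norm D ((*) x ` A)) = (cmod x)\<^sup>2"
proof -
  obtain n where n: "(cmod x)\<^sup>2 = real n" "x * cnj x = of_nat n"
    using norm_in_Nats[OF assms(1)] .
  have "n > 0" using n(1) assms(2) by (metis gr0I norm_eq_zero of_nat_0 power_eq_0_iff)
  have "cnj ` ((*) x ` A) = (*) (cnj x) ` A"
    by (auto simp: image_iff) (metis cnj_in_A complex_cnj_cnj)+
  then have cnj: "ideal_norm D ((*) (cnj x) ` A) = ideal_norm D ((*) x ` A)"
    by (metis ideal_norm_cnj)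
  have "(*) x ` ((*) (cnj x) ` A) = (*) (of_nat n) ` A"
    by (simp add: image_image n(2) flip: mult.assoc)
  then have "n\<^sup>2 = ideal_norm D ((*) x ` ((*) (cnj x) ` A))"
    using ideal_norm_of_nat[OF \<open>n > 0\<close>] by simp
  also have "\<dots> = (ideal_norm D ((*) x ` A))\<^sup>2"
    using ideal_norm_scale_principal[of "(*) (cnj x) ` A" x] assms
    by (simp add: add_subgroup_scale add_subgroup_A cnj power2_eq_square)
  finally have "n = ideal_norm D ((*) x ` A)" by simp
  then show ?thesis using n by simp
qed

lemma ideal_norm_scale:
  assumes "add_subgroup I" "x \<in> A" "x \<noteq> 0"
  shows "real (ideal_norm D ((*) x ` I)) = (cmod x)\<^sup>2 * ideal_norm D I"
  using ideal_norm_scale_principal[OF assms] ideal_norm_principal[OF assms(2,3)] by simp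

text \<open>\<open>A / I\<close> is a quotient of \<open>A / nA\<close>, which has
  \<open>n^2\<close> elements. Finiteness matters for the lower bound, because \<open>card\<close>
  of an infinite set is 0.\<close>

lemma ideal_norm_bounds:
  assumes I: "add_subgroup I" and n: "n > 0" and sub: "(*) (of_nat n) ` A \<subseteq> I"
  shows "0 < ideal_norm D I" "ideal_norm D I \<le> n\<^sup>2"
proof -
  let ?J = "(*) (of_nat n) ` A"
  have J: "add_subgroup ?J" by (simp add: add_subgroup_scale add_subgroup_A)
  have eq: "A // cong_rel I = (\<lambda>C. cong_rel I `` {SOME x. x \<in> C}) ` (A // cong_rel ?J)"
  proof (intro equalityI subsetI)
    fix Q assume "Q \<in> A // cong_rel I"
    then obtain a where a: "a \<in> A" "Q = cong_rel I `` {a}" by (rule quotientE)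
    define C where "C = cong_rel ?J `` {a}"
    have C: "C \<in> A // cong_rel ?J" unfolding C_def using a by (intro quotientI)
    have "a - (SOME x. x \<in> C) \<in> ?J"
      using cong_class_eq_iff[OF J a(1)] cong_class_rep[OF J C] C_def by metis
    then have "Q = cong_rel I `` {SOME x. x \<in> C}"
      using cong_class_eq_iff[OF I a(1)] cong_class_rep(1)[OF J C] sub a(2) by blast
    then show "Q \<in> (\<lambda>C. cong_rel I `` {SOME x. x \<in> C}) ` (A // cong_rel ?J)" using C by blast
  qed (use cong_class_rep(1)[OF J] in \<open>auto intro: quotientI\<close>)
  have fin: "finite (A // cong_rel I)" unfolding eq using finite_residues[OF n] by simp
  have "cong_rel I `` {0} \<in> A // cong_rel I" by (intro quotientI) simp
  with fin show "0 < ideal_norm D I" by (auto simp: ideal_norm_eq card_gt_0_iff)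
  have "ideal_norm D I \<le> card (A // cong_rel ?J)"
    unfolding ideal_norm_eq eq by (rule card_image_le[OF finite_residues[OF n]])
  also have "\<dots> = n\<^sup>2" using ideal_norm_of_nat[OF n] by (simp add: ideal_norm_eq)
  finally show "ideal_norm D I \<le> n\<^sup>2" .
qed

subsection \<open>The quadratic field\<close>

text \<open>Clearing denominators, with \<open>csqrt (of_int D) = 2 * \<omega> - of_int D\<close>.
  In this form the closure properties of the field reduce to those of \<open>A\<close>.\<close>

lemma quad_field_iff: "z \<in> quad_field D \<longleftrightarrow> (\<exists>x\<in>A. \<exists>n>0. z = x / of_nat n)"
proof
  assume "z \<in> quad_field D"
  then obtain p q where z: "z = of_rat p + of_rat q * csqrt (of_int D)"
    by (auto simp: quad_field_def)
  obtain a b where p: "p = of_int a / of_int b" and b: "b > 0"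
    by (metis quotient_of_denom_pos' quotient_of_div surj_pair snd_conv)
  obtain c d where q: "q = of_int c / of_int d" and d: "d > 0"
    by (metis quotient_of_denom_pos' quotient_of_div surj_pair snd_conv)
  have "of_rat q * csqrt (of_int D) = of_rat q * (2 * \<omega> - of_int D)" by (simp add: \<omega>_def field_simps)
  then have "z = of_rat p + of_rat q * (2 * \<omega> - of_int D)" by (simp add: z)
  then have "z = ring_elt (a * d - b * c * D) (2 * b * c) / of_nat (nat (b * d))"
    using b d by (simp add: p q of_rat_divide ring_elt_def field_simps)
  moreover have "nat (b * d) > 0" using b d by simp
  ultimately show "\<exists>x\<in>A. \<exists>n>0. z = x / of_nat n" using ring_elt_in_A by blast
next
  assume "\<exists>x\<in>A. \<exists>n>0. z = x / of_nat n"
  then obtain p q and n :: nat where n: "n > 0" and z: "z = ring_elt p q / of_nat n"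
    by (metis A_E)
  have "z = of_rat ((of_int p + of_int q * of_int D / 2) / of_nat n)
      + of_rat (of_int q / (2 * of_nat n)) * csqrt (of_int D)"
    using n by (simp add: z ring_elt_def \<omega>_def of_rat_divide of_rat_add of_rat_mult field_simps)
  then show "z \<in> quad_field D" unfolding quad_field_def by blast
qed

lemma A_subset_quad_field: "x \<in> A \<Longrightarrow> x \<in> quad_field D"
  unfolding quad_field_iff by (intro bexI[of _ x] exI[of _ 1]) auto

lemma quad_field_add:
  assumes "y \<in> quad_field D" "z \<in> quad_field D"
  shows "y + z \<in> quad_field D"
proof -
  obtain a b and m n :: nat where "a \<in> A" "b \<in> A" "m > 0" "n > 0" "y = a / of_nat m" "z = b / of_nat n"
    using assms unfolding quad_field_iff by blast
  then show ?thesis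
    unfolding quad_field_iff
    by (intro bexI[of _ "a * of_nat n + b * of_nat m"] exI[of _ "m * n"]) (auto simp: field_simps)
qed

lemma quad_field_mult:
  assumes "x \<in> A" "z \<in> quad_field D"
  shows "x * z \<in> quad_field D"
  using assms unfolding quad_field_iff by (metis mult_in_A times_divide_eq_right)

lemma quad_field_divide:
  assumes "a \<in> A" "b \<in> A"
  shows "a / b \<in> quad_field D"
proof (cases "b = 0")
  case True
  then show ?thesis using A_subset_quad_field[of 0] by simp
next
  case False
  obtain n where n: "b * cnj b = of_nat n" using norm_in_Nats[OF assms(2)] .
  with False have "n > 0" by (metis complex_cnj_zero_iff gr0I mult_eq_0_iff of_nat_0)
  moreover have "a / b = a * cnj b / of_nat n"
    using False by (simp flip: n)
  ultimately show ?thesis unfolding quad_field_iff using assms by (metis cnj_in_A mult_in_A)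
qed

lemma int_matrix_quad_plane:
  assumes "g \<in> int_matrices D" "w \<in> quad_plane D"
  shows "g *v w \<in> quad_plane D"
  using assms
  by (simp add: int_matrices_def quad_plane_def matrix_vector_mult_def sum_2 quad_field_add quad_field_mult)

subsection \<open>Lattice vectors and cusps\<close>

definition lattice0 :: "(complex^2) set" where
  "lattice0 = int_lattice D - {0}"

lemma lattice0_iff: "u \<in> lattice0 \<longleftrightarrow> u $ 1 \<in> A \<and> u $ 2 \<in> A \<and> (u $ 1 \<noteq> 0 \<or> u $ 2 \<noteq> 0)"
  by (auto simp: lattice0_def int_lattice_def forall_2 vec_eq_iff)

definition content_norm :: "complex^2 \<Rightarrow> nat" where
  "content_norm u = ideal_norm D (ideal2 D (u $ 1) (u $ 2))"

lemma ideal2_mult: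
  assumes "y \<in> A" "z \<in> ideal2 D a b"
  shows "y * z \<in> ideal2 D a b"
proof -
  obtain s t where "s \<in> A" "t \<in> A" "z = a * s + b * t" using assms(2) by (auto simp: ideal2_def)
  then have "y * z = a * (y * s) + b * (y * t)" "y * s \<in> A" "y * t \<in> A"
    using assms(1) by (auto simp: algebra_simps)
  then show ?thesis unfolding ideal2_def by blast
qed

lemma ideal2_diff:
  assumes "y \<in> ideal2 D a b" "z \<in> ideal2 D a b"
  shows "y - z \<in> ideal2 D a b"
proof -
  obtain s t s' t' where "s \<in> A" "t \<in> A" "y = a * s + b * t" "s' \<in> A" "t' \<in> A" "z = a * s' + b * t'"
    using assms by (auto simp: ideal2_def)
  then have "y - z = a * (s - s') + b * (t - t')" "s - s' \<in> A" "t - t' \<in> A"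
    by (auto simp: algebra_simps)
  then show ?thesis unfolding ideal2_def by blast
qed

lemma generators_in_ideal2: "a \<in> ideal2 D a b" "b \<in> ideal2 D a b"
proof -
  have "a = a * 1 + b * 0" "b = a * 0 + b * 1" by simp_all
  then show "a \<in> ideal2 D a b" "b \<in> ideal2 D a b"
    unfolding ideal2_def using zero_in_A one_in_A by blast+
qed

lemma add_subgroup_ideal2:
  assumes "a \<in> A" "b \<in> A"
  shows "add_subgroup (ideal2 D a b)"
proof -
  have "ideal2 D a b \<subseteq> A" using assms by (auto simp: ideal2_def)
  moreover have "0 \<in> ideal2 D a b" using ideal2_diff[OF generators_in_ideal2(1,1)] by simp
  ultimately show ?thesis by (simp add: add_subgroup_def ideal2_diff)
qed

lemma content_norm_le:
  assumes "u \<in> lattice0" "n > 0" "of_nat n \<in> ideal2 D (u $ 1) (u $ 2)"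
  shows "0 < content_norm u" "content_norm u \<le> n\<^sup>2"
proof -
  have "(*) (of_nat n) ` A \<subseteq> ideal2 D (u $ 1) (u $ 2)"
    using ideal2_mult[OF _ assms(3)] by (auto simp: mult.commute)
  then show "0 < content_norm u" "content_norm u \<le> n\<^sup>2"
    using ideal_norm_bounds[OF add_subgroup_ideal2] assms by (auto simp: content_norm_def lattice0_iff)
qed

text \<open>The content ideal contains a non-zero coordinate \<open>x\<close> of \<open>u\<close>,
  hence also the positive integer \<open>x * cnj x\<close>.\<close>

lemma content_norm_pos:
  assumes u: "u \<in> lattice0"
  shows "0 < content_norm u"
proof -
  obtain x where x: "x \<in> ideal2 D (u $ 1) (u $ 2)" "x \<in> A" "x \<noteq> 0"
    using u generators_in_ideal2 unfolding lattice0_iff by metis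
  obtain n where n: "x * cnj x = of_nat n" using norm_in_Nats[OF x(2)] .
  with x(3) have "n > 0" by (metis complex_cnj_zero_iff gr0I mult_eq_0_iff of_nat_0)
  moreover have "of_nat n \<in> ideal2 D (u $ 1) (u $ 2)"
    using ideal2_mult[OF cnj_in_A[OF x(2)] x(1)] n by (simp add: mult.commute)
  ultimately show ?thesis by (rule content_norm_le(1)[OF u])
qed

lemma ideal2_scale: "ideal2 D (x * a) (x * b) = (*) x ` ideal2 D a b"
proof -
  have "x * a * s + x * b * t = x * (a * s + b * t)" for s t by (simp add: algebra_simps)
  then show ?thesis unfolding ideal2_def by (simp only:) blast
qed

lemma content_norm_scale:
  assumes "u \<in> lattice0" "x \<in> A" "x \<noteq> 0"
  shows "real (content_norm (x *s u)) = (cmod x)\<^sup>2 * content_norm u"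
  using assms by (simp add: content_norm_def lattice0_iff ideal2_scale ideal_norm_scale add_subgroup_ideal2)

text \<open>Cross-multiplication. Two integral factors are kept instead of one quotient in the
  field, to match the scaling lemmas, whose factors lie in \<open>A\<close>.\<close>

lemma same_cusp_E:
  assumes "u \<in> lattice0" "v \<in> lattice0" "cusp_of u = cusp_of v"
  obtains x y where "x \<in> A" "y \<in> A" "x \<noteq> 0" "y \<noteq> 0" "x *s u = y *s v"
proof (cases "u $ 2 = 0")
  case True
  then have v2: "v $ 2 = 0" using assms(3) by (auto simp: cusp_of_def split: if_splits)
  show ?thesis
    by (rule that[of "v $ 1" "u $ 1"]) (use True v2 assms(1,2) in \<open>auto simp: lattice0_iff vec_eq_iff forall_2\<close>)
next
  case False
  then have v2: "v $ 2 \<noteq> 0" and "u $ 1 / u $ 2 = v $ 1 / v $ 2"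
    using assms(3) by (auto simp: cusp_of_def split: if_splits)
  then have "v $ 2 * u $ 1 = u $ 2 * v $ 1" using False by (simp add: field_simps)
  then show ?thesis
    by (intro that[of "v $ 2" "u $ 2"]) (use False v2 assms(1,2) in \<open>auto simp: lattice0_iff vec_eq_iff forall_2\<close>)
qed

lemma cusps_eq: "cusps D = cusp_of ` lattice0"
proof (intro equalityI subsetI)
  fix \<alpha> assume "\<alpha> \<in> cusps D"
  from cusp_rep[OF this] show "\<alpha> \<in> cusp_of ` lattice0" by (force simp: lattice0_def)
next
  fix \<alpha> assume "\<alpha> \<in> cusp_of ` lattice0"
  then show "\<alpha> \<in> cusps D"
    by (auto simp: cusps_def cusp_of_def lattice0_iff quad_field_divide)
qed

section \<open>Distances to cusps, computed from arbitrary representatives\<close>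

definition vec_dist :: "complex^2 \<Rightarrow> complex \<times> real \<Rightarrow> real" where
  "vec_dist u w = height_form w u / content_norm u"

lemma vec_dist_scale:
  assumes "u \<in> lattice0" "x \<in> A" "x \<noteq> 0"
  shows "vec_dist (x *s u) w = vec_dist u w"
  using assms by (simp add: vec_dist_def height_form_scale content_norm_scale)

lemma vec_dist_cong:
  assumes "u \<in> lattice0" "v \<in> lattice0" "cusp_of u = cusp_of v"
  shows "vec_dist u w = vec_dist v w"
  using same_cusp_E[OF assms] vec_dist_scale assms(1,2) by metis

text \<open>This removes the arbitrary choice in \<open>cusp_rep\<close>. At infinity the content
  ideal is principal and its norm cancels against the height form; at a finite cusp the denominator
  is factored out.\<close>

lemma cusp_dist_eq:
  assumes u: "u \<in> lattice0"
  shows "cusp_dist D (cusp_of u) w = vec_dist u w"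
proof -
  define r where "r = cusp_rep D (cusp_of u)"
  have "cusp_of u \<in> cusps D" using u by (simp add: cusps_eq)
  from cusp_rep[OF this] have r: "r \<in> lattice0" "cusp_of r = cusp_of u"
    by (auto simp: r_def lattice0_def)
  have norm_r: "cusp_ideal_norm D (cusp_of u) = content_norm r"
    by (simp add: cusp_ideal_norm_def content_norm_def r_def)
  obtain z \<zeta> where w: "w = (z, \<zeta>)" by (cases w)
  have "cusp_dist D (cusp_of u) w = vec_dist r w"
  proof (cases "r $ 2 = 0")
    case True
    then have "cusp_of u = Infty" "r $ 1 \<in> A" "r $ 1 \<noteq> 0" using r by (auto simp: cusp_of_def lattice0_iff)
    moreover have "ideal2 D (r $ 1) 0 = (*) (r $ 1) ` A" by (auto simp: ideal2_def)
    ultimately show ?thesis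
      using True ideal_norm_principal[of "r $ 1"] by (simp add: w vec_dist_def height_form_def content_norm_def)
  next
    case False
    then have fin: "cusp_of u = Fin (r $ 1 / r $ 2)" using r by (simp add: cusp_of_def)
    then have rep_r: "cusp_rep D (Fin (r $ 1 / r $ 2)) = r" by (metis r_def)
    have "r $ 1 - r $ 2 * z = - (r $ 2 * (z - r $ 1 / r $ 2))" using False by (simp add: field_simps)
    then have "(cmod (r $ 1 - r $ 2 * z))\<^sup>2 = (cmod (r $ 2))\<^sup>2 * (cmod (z - r $ 1 / r $ 2))\<^sup>2"
      by (simp only: norm_minus_cancel norm_mult power_mult_distrib)
    moreover have "cusp_dist D (Fin (r $ 1 / r $ 2)) w = (cmod (r $ 2))\<^sup>2 / content_norm r
        * (((cmod (z - r $ 1 / r $ 2))\<^sup>2 + \<zeta>\<^sup>2) / \<zeta>)"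
      using norm_r rep_r by (simp add: w cnorm2_def fin)
    ultimately have "cusp_dist D (Fin (r $ 1 / r $ 2)) w = vec_dist r w"
      by (simp add: w vec_dist_def height_form_def distrib_left add_divide_distrib mult_ac del: cusp_dist.simps)
    then show ?thesis by (simp only: fin)
  qed
  also have "\<dots> = vec_dist u w" using r u by (intro vec_dist_cong)
  finally show ?thesis .
qed

definition vec_region :: "complex^2 \<Rightarrow> (complex \<times> real) set" where
  "vec_region u = {w \<in> hyp3. \<forall>v\<in>lattice0. vec_dist u w \<le> vec_dist v w}"

lemma cusp_region_eq: "u \<in> lattice0 \<Longrightarrow> cusp_region D (cusp_of u) = vec_region u"
  by (simp add: cusp_region_def vec_region_def cusps_eq cusp_dist_eq)

text \<open>For high points the vector \<open>(1, 0)\<close> is short. For low points, Dirichlet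
  approximation of \<open>z\<close> with \<open>k\<close> near \<open>1 / sqrt \<zeta>\<close> makes
  both \<open>|a - b z|^2\<close> and \<open>|b|^2 \<zeta>^2\<close> of order \<zeta>.\<close>

lemma hermite_bound:
  obtains C where "C > 0" "\<And>w. w \<in> hyp3 \<Longrightarrow> \<exists>v\<in>lattice0. height_form w v \<le> C"
proof
  define c where "c = dirichlet_const"
  have c: "c > 0" by (simp add: c_def dirichlet_const_pos)
  \<comment> \<open>The 5 is 1 + 4, the bounds of the two terms relative to
    \<open>c^2 * \<zeta>\<close>; the summand 1 covers the points with \<zeta> \<ge> 1.\<close>
  show "1 + 5 * c\<^sup>2 > 0" by (simp add: add_pos_nonneg)
  fix w :: "complex \<times> real" assume "w \<in> hyp3"
  then obtain z \<zeta> where w: "w = (z, \<zeta>)" and \<zeta>: "\<zeta> > 0" by (auto simp: hyp3_def)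
  show "\<exists>v\<in>lattice0. height_form w v \<le> 1 + 5 * c\<^sup>2"
  proof (cases "\<zeta> \<ge> 1")
    case True
    then have "1 / \<zeta> \<le> 1" by simp
    then have "1 / \<zeta> \<le> 1 + 5 * c\<^sup>2" by (smt (verit) zero_le_power2)
    then show ?thesis
      by (intro bexI[of _ "vector [1, 0]"]) (auto simp: lattice0_iff height_form_def w)
  next
    case False
    \<comment> \<open>Rounding up gives \<open>1 \<le> k^2 * \<zeta> \<le> 4\<close>, the upper
      bound because \<zeta> is below 1 here.\<close>
    define k where "k = nat \<lceil>1 / sqrt \<zeta>\<rceil>"
    have k1: "1 / sqrt \<zeta> \<le> real k" unfolding k_def by (rule real_nat_ceiling_ge)
    have "real k < 1 / sqrt \<zeta> + 1" using \<zeta> by (simp add: k_def) linarith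
    also have "\<dots> \<le> 2 / sqrt \<zeta>" using False \<zeta> by (simp add: field_simps real_le_rsqrt power_le_one_iff power2_eq_square mult_le_cancel_right1)
    finally have k2: "real k \<le> 2 / sqrt \<zeta>" by simp
    have kpos: "real k > 0" using k1 \<zeta> by (smt (verit) divide_pos_pos real_sqrt_gt_zero)
    then have "k \<ge> 1" by simp
    have "(real k)\<^sup>2 \<le> (2 / sqrt \<zeta>)\<^sup>2" using k2 by (intro power_mono) auto
    then have kk2: "(real k)\<^sup>2 * \<zeta> \<le> 4" using \<zeta> by (simp add: power_divide field_simps)
    have "(1 / sqrt \<zeta>)\<^sup>2 \<le> (real k)\<^sup>2" using k1 \<zeta> by (intro power_mono) auto
    then have kk1: "1 \<le> (real k)\<^sup>2 * \<zeta>" using \<zeta> by (simp add: power_divide field_simps)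
    obtain a b where ab: "a \<in> A" "b \<in> A" "b \<noteq> 0" "cmod b \<le> c * k" "cmod (a - b * z) \<le> c / k"
      using dirichlet_approximation[OF \<open>k \<ge> 1\<close>, of z] unfolding c_def by blast
    have "(cmod (a - b * z))\<^sup>2 \<le> (c / k)\<^sup>2" using ab by (intro power_mono) auto
    also have "\<dots> \<le> c\<^sup>2 * \<zeta>"
      using mult_left_mono[OF kk1, of "c\<^sup>2"] kpos by (simp add: power_divide field_simps)
    finally have 1: "(cmod (a - b * z))\<^sup>2 \<le> c\<^sup>2 * \<zeta>" .
    have "(cmod b)\<^sup>2 \<le> (c * k)\<^sup>2" using ab by (intro power_mono) auto
    then have "(cmod b)\<^sup>2 * \<zeta> \<le> c\<^sup>2 * ((real k)\<^sup>2 * \<zeta>)"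
      using \<zeta> by (simp add: power_mult_distrib flip: mult.assoc)
    also have "\<dots> \<le> c\<^sup>2 * 4" by (intro mult_left_mono kk2) auto
    finally have "(cmod b)\<^sup>2 * \<zeta> * \<zeta> \<le> c\<^sup>2 * 4 * \<zeta>" using \<zeta> by (intro mult_right_mono) auto
    then have "(cmod b)\<^sup>2 * \<zeta>\<^sup>2 \<le> 4 * (c\<^sup>2 * \<zeta>)" by (simp add: power2_eq_square mult_ac)
    with 1 have "(cmod (a - b * z))\<^sup>2 + (cmod b)\<^sup>2 * \<zeta>\<^sup>2 \<le> (1 + 5 * c\<^sup>2) * \<zeta>"
      using \<zeta> by (simp add: distrib_right)
    then have "height_form w (vector [a, b]) \<le> 1 + 5 * c\<^sup>2"
      using \<zeta> by (simp add: height_form_def w divide_le_eq)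
    moreover have "vector [a, b] \<in> lattice0" using ab by (simp add: lattice0_iff)
    ultimately show ?thesis by blast
  qed
qed

text \<open>
  Finiteness of the class group, in the form used here: with \<open>x\<close> a shortest element of the ideal
  of \<open>u\<close>, a fixed integer multiple of that ideal lies in \<open>xA\<close>, so \<open>u\<close> can be rescaled by \<open>m / x\<close>.
\<close>

lemma reduced_representative:
  obtains m where "m > 0"
    "\<And>u. u \<in> lattice0 \<Longrightarrow> \<exists>v\<in>lattice0. cusp_of v = cusp_of u \<and> content_norm v \<le> m\<^sup>2"
proof
  define c where "c = dirichlet_const"
  \<comment> \<open>Since \<open>k\<close> exceeds \<open>c\<close>, the approximation error
    \<open>c / k\<close> is below 1. \<open>M\<close> bounds the norms of the denominators
    \<open>b\<close>, so each of these norms divides \<open>fact M\<close>.\<close>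
  define k where "k = nat \<lceil>c\<rceil> + 1"
  define M where "M = nat \<lfloor>(c * k)\<^sup>2\<rfloor>"
  have c: "c > 0" by (simp add: c_def dirichlet_const_pos)
  have k: "real k > c" "k \<ge> 1" unfolding k_def by linarith+
  show "(fact M :: nat) > 0" by simp
  fix u assume u: "u \<in> lattice0"
  define I where "I = ideal2 D (u $ 1) (u $ 2)"
  have IA: "I \<subseteq> A" using add_subgroup_ideal2 u by (simp add: I_def add_subgroup_def lattice0_iff)
  define \<nu> where "\<nu> x = nat \<lfloor>(cmod x)\<^sup>2\<rfloor>" for x
  have \<nu>: "real (\<nu> x) = (cmod x)\<^sup>2" if "x \<in> A" for x
    using norm_in_Nats[OF that] by (metis \<nu>_def floor_of_nat nat_int)
  have "\<exists>x. x \<in> I \<and> x \<noteq> 0" using u generators_in_ideal2 unfolding I_def lattice0_iff by metis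
  then obtain x where x: "x \<in> I" "x \<noteq> 0" and min: "\<And>y. y \<in> I \<Longrightarrow> y \<noteq> 0 \<Longrightarrow> \<nu> x \<le> \<nu> y"
    using ex_has_least_nat[of "\<lambda>x. x \<in> I \<and> x \<noteq> 0" _ \<nu>] by blast
  have *: "fact M * y / x \<in> A" if y: "y \<in> I" for y
  proof -
    \<comment> \<open>A replacement for division with remainder: \<open>a * x - b * y\<close> lies
      in the ideal and is shorter than the shortest non-zero element \<open>x\<close>, so it
      vanishes. Then \<open>y / x = a / b\<close>, and the norm of \<open>b\<close> clears the
      denominator.\<close>
    obtain a b where ab: "a \<in> A" "b \<in> A" "b \<noteq> 0" "cmod b \<le> c * k" "cmod (a - b * (y / x)) \<le> c / k"
      using dirichlet_approximation[OF k(2)] unfolding c_def by blast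
    have "cmod (a - b * (y / x)) < 1" using ab(5) k c by (smt (verit) divide_less_eq_1_pos)
    then have "cmod x * cmod (a - b * (y / x)) < cmod x" using x(2) by simp
    moreover have "x * (a - b * (y / x)) = a * x - b * y" using x(2) by (simp add: field_simps)
    ultimately have less: "cmod (a * x - b * y) < cmod x" by (metis norm_mult)
    have in_I: "a * x - b * y \<in> I" using x(1) y ab ideal2_mult ideal2_diff by (simp add: I_def)
    have "a * x - b * y = 0"
    proof (rule ccontr)
      assume "a * x - b * y \<noteq> 0"
      then have "real (\<nu> x) \<le> real (\<nu> (a * x - b * y))" using min in_I by simp
      then have "(cmod x)\<^sup>2 \<le> (cmod (a * x - b * y))\<^sup>2" using \<nu> x in_I IA by (metis subsetD)
      with less show False by (simp add: power2_le_iff_abs_le)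
    qed
    then have yx: "y / x = a / b" using ab(3) x(2) by (simp add: field_simps)
    obtain n where n: "(cmod b)\<^sup>2 = real n" "b * cnj b = of_nat n" using norm_in_Nats[OF ab(2)] .
    have "(cmod b)\<^sup>2 \<le> (c * k)\<^sup>2" using ab(4) by (intro power_mono) auto
    then have "n \<le> M" using n(1) by (simp add: M_def le_nat_floor)
    moreover have "n > 0" using n(1) ab(3) by (metis gr0I norm_eq_zero of_nat_0 power_eq_0_iff)
    ultimately have "n dvd fact M" by (simp add: dvd_fact)
    then obtain l where l: "fact M = n * l" by blast
    have "fact M * y / x = of_nat (fact M) * (y / x)" by simp
    also have "\<dots> = of_nat l * (b * cnj b) * (a / b)"
      by (simp only: l n(2) yx of_nat_mult mult.commute mult.left_commute)
    also have "\<dots> = of_nat l * cnj b * a" using ab(3) by simp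
    finally show ?thesis using ab by simp
  qed
  define v where "v = (fact M / x) *s u"
  have v_nth: "v $ i = fact M * u $ i / x" for i by (simp add: v_def)
  have v: "v \<in> lattice0"
    using *[of "u $ 1"] *[of "u $ 2"] u x(2) generators_in_ideal2
    unfolding lattice0_iff I_def v_nth by simp
  moreover have "cusp_of v = cusp_of u" unfolding v_def using x(2) by (intro cusp_of_scale) simp
  \<comment> \<open>The combination of the coordinates of \<open>u\<close> that yields
    \<open>x\<close> yields \<open>fact M\<close> after the rescaling.\<close>
  moreover have "of_nat (fact M) \<in> ideal2 D (v $ 1) (v $ 2)"
  proof -
    obtain s t where "s \<in> A" "t \<in> A" "x = u $ 1 * s + u $ 2 * t" using x(1) by (auto simp: I_def ideal2_def)
    moreover have "v $ 1 * s + v $ 2 * t = fact M * (u $ 1 * s + u $ 2 * t) / x"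
      by (simp add: v_nth distrib_left add_divide_distrib mult.assoc)
    ultimately have "of_nat (fact M) = v $ 1 * s + v $ 2 * t" "s \<in> A" "t \<in> A"
      using x(2) by simp_all
    then show ?thesis unfolding ideal2_def by blast
  qed
  then have "content_norm v \<le> (fact M)\<^sup>2" by (intro content_norm_le(2)[OF v]) auto
  ultimately show "\<exists>v\<in>lattice0. cusp_of v = cusp_of u \<and> content_norm v \<le> (fact M)\<^sup>2" by blast
qed

subsection \<open>The unitary group\<close>

lemma GL2_det: "g \<in> GL2 D \<Longrightarrow> det g \<noteq> 0"
  unfolding GL2_def by (auto dest!: arg_cong[where f = det] simp: det_mul)

lemma GL2_inverse_E:
  assumes "g \<in> GL2 D"
  obtains h where "h \<in> GL2 D" "g ** h = mat 1" "h ** g = mat 1"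
  using assms unfolding GL2_def by blast

lemma int_matrices_mult: "g \<in> int_matrices D \<Longrightarrow> h \<in> int_matrices D \<Longrightarrow> g ** h \<in> int_matrices D"
  by (simp add: int_matrices_def matrix_matrix_mult_def sum_2)

lemma GL2_mult:
  assumes "g \<in> GL2 D" "h \<in> GL2 D"
  shows "g ** h \<in> GL2 D"
proof -
  obtain g' where g': "g' \<in> GL2 D" "g ** g' = mat 1" "g' ** g = mat 1" using assms(1) by (rule GL2_inverse_E)
  obtain h' where h': "h' \<in> GL2 D" "h ** h' = mat 1" "h' ** h = mat 1" using assms(2) by (rule GL2_inverse_E)
  have "(g ** h) ** (h' ** g') = g ** (h ** h') ** g'" "(h' ** g') ** (g ** h) = h' ** (g' ** g) ** h"
    by (simp_all only: matrix_mul_assoc)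
  then have "(g ** h) ** (h' ** g') = mat 1" "(h' ** g') ** (g ** h) = mat 1"
    by (simp_all add: g' h')
  moreover have "g ** h \<in> int_matrices D" "h' ** g' \<in> int_matrices D"
    using assms g'(1) h'(1) by (auto simp: GL2_def intro: int_matrices_mult)
  ultimately show ?thesis unfolding GL2_def by blast
qed

lemma unitary_group_mult:
  assumes "g \<in> unitary_group D f" "h \<in> unitary_group D f"
  shows "g ** h \<in> unitary_group D f"
  using assms GL2_mult int_matrix_quad_plane[of h]
  by (auto simp: unitary_group_def GL2_def simp flip: matrix_vector_mul_assoc)

lemma unitary_group_inverse_E:
  assumes "g \<in> unitary_group D f"
  obtains h where "h \<in> unitary_group D f" "g ** h = mat 1" "h ** g = mat 1"
proof -
  have g: "g \<in> GL2 D" using assms by (simp add: unitary_group_def)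
  then obtain h where h: "h \<in> GL2 D" "g ** h = mat 1" "h ** g = mat 1" by (rule GL2_inverse_E)
  have "f (h *v w) = f w" if w: "w \<in> quad_plane D" for w
  proof -
    have "h *v w \<in> quad_plane D" using h(1) w by (auto simp: GL2_def intro: int_matrix_quad_plane)
    then have "f (g *v (h *v w)) = f (h *v w)" using assms by (simp add: unitary_group_def)
    then show ?thesis by (simp add: matrix_vector_mul_assoc h(2))
  qed
  with h show thesis by (intro that) (auto simp: unitary_group_def)
qed

text \<open>The group law gives one inclusion for every group element; applying it to
  \<open>g\<close> and to its inverse gives equality.\<close>

lemma unitary_orbit_translate:
  assumes g: "g \<in> unitary_group D f" and w: "w \<in> hyp3"
  shows "unitary_orbit D f (poincare_ext g w) = unitary_orbit D f w"
proof -
  have det: "det h \<noteq> 0" if "h \<in> unitary_group D f" for h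
    using that GL2_det by (simp add: unitary_group_def)
  have sub: "unitary_orbit D f (poincare_ext h v) \<subseteq> unitary_orbit D f v"
    if h: "h \<in> unitary_group D f" and v: "v \<in> hyp3" for h v
  proof -
    have "poincare_ext k (poincare_ext h v) = poincare_ext (k ** h) v" "k ** h \<in> unitary_group D f"
      if "k \<in> unitary_group D f" for k
      using poincare_ext_mult det that h v unitary_group_mult by auto
    then show ?thesis unfolding unitary_orbit_def by blast
  qed
  obtain h where h: "h \<in> unitary_group D f" "h ** g = mat 1"
    using unitary_group_inverse_E[OF g] by metis
  have "poincare_ext h (poincare_ext g w) = w"
    using poincare_ext_mult[OF det[OF g] det[OF h(1)] w] h(2) by (simp add: poincare_ext_one)
  then show ?thesis
    using sub[OF g w] sub[OF h(1) poincare_ext_hyp3[OF det[OF g] w]] by auto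
qed

lemma ideal2_int_matrix:
  assumes "g \<in> int_matrices D"
  shows "ideal2 D ((g *v u) $ 1) ((g *v u) $ 2) \<subseteq> ideal2 D (u $ 1) (u $ 2)"
proof
  fix y assume "y \<in> ideal2 D ((g *v u) $ 1) ((g *v u) $ 2)"
  then obtain s t where st: "s \<in> A" "t \<in> A" "y = (g *v u) $ 1 * s + (g *v u) $ 2 * t"
    by (auto simp: ideal2_def)
  have "y = u $ 1 * (g $ 1 $ 1 * s + g $ 2 $ 1 * t) + u $ 2 * (g $ 1 $ 2 * s + g $ 2 $ 2 * t)"
    by (simp add: st matrix_vector_mult_def sum_2 algebra_simps)
  moreover have "g $ 1 $ 1 * s + g $ 2 $ 1 * t \<in> A" "g $ 1 $ 2 * s + g $ 2 $ 2 * t \<in> A"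
    using assms st by (simp_all add: int_matrices_def)
  ultimately show "y \<in> ideal2 D (u $ 1) (u $ 2)" unfolding ideal2_def by blast
qed

text \<open>Both \<open>g\<close> and its inverse are integral, so the two content ideals contain
  each other.\<close>

lemma content_norm_GL2:
  assumes "g \<in> GL2 D"
  shows "content_norm (g *v u) = content_norm u"
proof -
  obtain h where "h \<in> GL2 D" "h ** g = mat 1" using GL2_inverse_E[OF assms] by metis
  then have "ideal2 D ((g *v u) $ 1) ((g *v u) $ 2) = ideal2 D (u $ 1) (u $ 2)"
    using ideal2_int_matrix[of g u] ideal2_int_matrix[of h "g *v u"] assms
    by (auto simp: GL2_def matrix_left_inverse_vector)
  then show ?thesis by (simp add: content_norm_def)
qed

lemma lattice0_GL2:
  assumes "g \<in> GL2 D" "u \<in> lattice0"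
  shows "g *v u \<in> lattice0"
proof -
  obtain h where "h ** g = mat 1" using GL2_inverse_E[OF assms(1)] by metis
  then have "g *v u \<noteq> 0" using assms(2) matrix_left_inverse_vector[of h g u] by (auto simp: lattice0_def)
  moreover have "g *v u \<in> int_lattice D"
    using assms by (simp add: lattice0_def int_lattice_def GL2_def int_matrices_def matrix_vector_mult_def sum_2)
  ultimately show ?thesis by (simp add: lattice0_def)
qed

text \<open>Moving vector and point together multiplies every distance by the same factor
  \<open>cmod (det g)\<close>, and each competitor \<open>v\<close> is the image of the lattice
  vector \<open>h *v v\<close>.\<close>

lemma vec_region_translate:
  assumes g: "g \<in> GL2 D" and w: "w \<in> vec_region u"
  shows "poincare_ext g w \<in> vec_region (g *v u)"
proof -
  have w3: "w \<in> hyp3" using w by (simp add: vec_region_def)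
  have dist: "vec_dist (g *v v) (poincare_ext g w) = cmod (det g) * vec_dist v w" for v
    by (simp add: vec_dist_def content_norm_GL2[OF g] height_form_poincare_ext[OF GL2_det[OF g] w3])
  obtain h where h: "h \<in> GL2 D" "g ** h = mat 1" using GL2_inverse_E[OF g] by metis
  have "vec_dist (g *v u) (poincare_ext g w) \<le> vec_dist v (poincare_ext g w)" if "v \<in> lattice0" for v
  proof -
    have "vec_dist u w \<le> vec_dist (h *v v) w"
      using w lattice0_GL2[OF h(1) that] by (simp add: vec_region_def)
    then have "cmod (det g) * vec_dist u w \<le> cmod (det g) * vec_dist (h *v v) w"
      by (intro mult_left_mono) auto
    then show ?thesis by (simp add: matrix_left_inverse_vector[OF h(2)] flip: dist)
  qed
  then show ?thesis using poincare_ext_hyp3[OF GL2_det[OF g] w3] by (simp add: vec_region_def)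
qed

subsection \<open>Compactness of cells\<close>

text \<open>A Hermite constant for the forms of all points, fixed once because the compactness and
  the finiteness arguments both use it.\<close>

definition min_const :: real where
  "min_const = (SOME C. C > 0 \<and> (\<forall>w\<in>hyp3. \<exists>v\<in>lattice0. height_form w v \<le> C))"

lemma min_const_pos: "min_const > 0"
  and min_const_bound: "w \<in> hyp3 \<Longrightarrow> \<exists>v\<in>lattice0. height_form w v \<le> min_const"
proof -
  have "\<exists>C. C > 0 \<and> (\<forall>w\<in>hyp3. \<exists>v\<in>lattice0. height_form w v \<le> C)"
    using hermite_bound by metis
  from someI_ex[OF this] show "min_const > 0"
    and "w \<in> hyp3 \<Longrightarrow> \<exists>v\<in>lattice0. height_form w v \<le> min_const"
    by (auto simp: min_const_def)
qed

text \<open>\<open>u\<close> is at most as distant as the short vector \<open>v\<close> of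
  \<open>min_const_bound\<close>, and the content norm of \<open>v\<close> is at least 1.\<close>

lemma height_le_content:
  assumes u: "u \<in> lattice0" and w: "w \<in> vec_region u"
  shows "height_form w u \<le> min_const * content_norm u"
proof -
  have w3: "w \<in> hyp3" using w by (simp add: vec_region_def)
  obtain v where v: "v \<in> lattice0" "height_form w v \<le> min_const" using min_const_bound[OF w3] by blast
  have "vec_dist u w \<le> vec_dist v w" using w v by (simp add: vec_region_def)
  also have "\<dots> \<le> height_form w v"
    using content_norm_pos[OF v(1)] height_form_nonneg[OF w3, of v]
    by (simp add: vec_dist_def divide_le_eq mult_le_cancel_left1)
  also have "\<dots> \<le> min_const" by (rule v)
  finally show ?thesis
    using content_norm_pos[OF u] by (simp add: vec_dist_def divide_le_eq)
qed

lemma continuous_on_vec_dist: "u \<in> lattice0 \<Longrightarrow> continuous_on hyp3 (vec_dist u)"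
  unfolding vec_dist_def height_form_def
  by (intro continuous_intros) (auto simp: hyp3_def content_norm_pos)

text \<open>Both heights are bounded by \<open>B\<close> on the cell. As \<open>u\<close> and
  \<open>v\<close> are independent, \<zeta> cannot tend to 0; as one of the two cusps is finite, its
  height bounds \<zeta> from above and confines \<open>z\<close> to a disc. Thus the cell is a
  closed part of a compact box inside \<open>hyp3\<close>.\<close>

lemma compact_vec_region_Int:
  assumes u: "u \<in> lattice0" and v: "v \<in> lattice0" and det: "u $ 1 * v $ 2 - v $ 1 * u $ 2 \<noteq> 0"
  shows "compact (vec_region u \<inter> vec_region v)"
proof -
  define B where "B = min_const * max (content_norm u) (content_norm v)"
  define \<delta> where "\<delta> = cmod (u $ 1 * v $ 2 - v $ 1 * u $ 2)"
  define S where "S = vec_region u \<inter> vec_region v"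
  have \<delta>: "\<delta> > 0" using det by (simp add: \<delta>_def)
  have B: "B > 0" using min_const_pos content_norm_pos[OF u] by (simp add: B_def)
  have ht: "height_form w u \<le> B" "height_form w v \<le> B" if "w \<in> S" for w
  proof -
    have "min_const * content_norm u \<le> B" "min_const * content_norm v \<le> B"
      using min_const_pos by (simp_all add: B_def)
    then show "height_form w u \<le> B" "height_form w v \<le> B"
      using height_le_content[OF u, of w] height_le_content[OF v, of w] that by (auto simp: S_def)
  qed
  have S3: "w \<in> hyp3" if "w \<in> S" for w using that by (simp add: S_def vec_region_def)
  \<comment> \<open>The lower bound for \<zeta> comes from squaring \<open>\<delta> \<le> (cmod (u $
    2) + cmod (v $ 2)) * sqrt (B * \<zeta>)\<close>; the added 1 makes the denominator visibly
    positive.\<close>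
  define \<epsilon> where "\<epsilon> = \<delta>\<^sup>2 / (B * (cmod (u $ 2) + cmod (v $ 2))\<^sup>2 + 1)"
  have "B * (cmod (u $ 2) + cmod (v $ 2))\<^sup>2 + 1 > 0" using B by (intro add_nonneg_pos) auto
  then have \<epsilon>: "\<epsilon> > 0" using \<delta> by (simp add: \<epsilon>_def)
  \<comment> \<open>A non-zero determinant forces one second coordinate to be non-zero; that vector
    represents a finite cusp.\<close>
  obtain x y where xy: "x \<in> {u, v}" "x $ 2 = y" "y \<noteq> 0"
    using det by (cases "u $ 2 = 0") auto
  define M where "M = B / (cmod y)\<^sup>2"
  define T where "T = cball (x $ 1 / y) M \<times> {\<epsilon>..M}"
  have ST: "w \<in> T" if w: "w \<in> S" for w
  proof -
    obtain z \<zeta> where wz: "w = (z, \<zeta>)" and \<zeta>: "\<zeta> > 0" using S3[OF w] by (auto simp: hyp3_def)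
    have bound: "(cmod (t $ 1 - t $ 2 * z))\<^sup>2 + (cmod (t $ 2))\<^sup>2 * \<zeta>\<^sup>2 \<le> B * \<zeta>" if "t \<in> {u, v}" for t
      using ht[OF w] that \<zeta> by (auto simp: height_form_def wz divide_le_eq)
    have root: "cmod (t $ 1 - t $ 2 * z) \<le> sqrt (B * \<zeta>)" if "t \<in> {u, v}" for t
    proof (rule real_le_rsqrt)
      have "0 \<le> (cmod (t $ 2))\<^sup>2 * \<zeta>\<^sup>2" by simp
      with bound[OF that] show "(cmod (t $ 1 - t $ 2 * z))\<^sup>2 \<le> B * \<zeta>" by linarith
    qed
    have "u $ 1 * v $ 2 - v $ 1 * u $ 2 = v $ 2 * (u $ 1 - u $ 2 * z) - u $ 2 * (v $ 1 - v $ 2 * z)"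
      by (simp add: algebra_simps)
    then have "\<delta> \<le> cmod (v $ 2) * cmod (u $ 1 - u $ 2 * z) + cmod (u $ 2) * cmod (v $ 1 - v $ 2 * z)"
      unfolding \<delta>_def by (metis norm_mult norm_triangle_ineq4)
    also have "\<dots> \<le> cmod (v $ 2) * sqrt (B * \<zeta>) + cmod (u $ 2) * sqrt (B * \<zeta>)"
      using root by (intro add_mono mult_left_mono) auto
    finally have "\<delta> \<le> (cmod (u $ 2) + cmod (v $ 2)) * sqrt (B * \<zeta>)" by (simp add: algebra_simps)
    then have "\<delta>\<^sup>2 \<le> ((cmod (u $ 2) + cmod (v $ 2)) * sqrt (B * \<zeta>))\<^sup>2"
      using \<delta> by (intro power_mono) auto
    also have "\<dots> = B * (cmod (u $ 2) + cmod (v $ 2))\<^sup>2 * \<zeta>"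
      using B \<zeta> by (simp add: power_mult_distrib)
    also have "\<dots> \<le> (B * (cmod (u $ 2) + cmod (v $ 2))\<^sup>2 + 1) * \<zeta>"
      using \<zeta> by (intro mult_right_mono) auto
    finally have low: "\<epsilon> \<le> \<zeta>"
      using \<open>B * (cmod (u $ 2) + cmod (v $ 2))\<^sup>2 + 1 > 0\<close> by (simp add: \<epsilon>_def divide_le_eq mult.commute)
    have b: "(cmod (x $ 1 - y * z))\<^sup>2 + (cmod y)\<^sup>2 * \<zeta>\<^sup>2 \<le> B * \<zeta>" using bound[OF xy(1)] xy(2) by simp
    have "(cmod y)\<^sup>2 * \<zeta> * \<zeta> \<le> B * \<zeta>"
      using b by (smt (verit) zero_le_power2 power2_eq_square mult.assoc)
    then have "(cmod y)\<^sup>2 * \<zeta> \<le> B" using \<zeta> by simp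
    then have up: "\<zeta> \<le> M" using xy(3) by (simp add: M_def field_simps)
    have "x $ 1 - y * z = y * (x $ 1 / y - z)" using xy(3) by (simp add: field_simps)
    then have "(cmod y)\<^sup>2 * (cmod (x $ 1 / y - z))\<^sup>2 = (cmod (x $ 1 - y * z))\<^sup>2"
      by (simp only: norm_mult power_mult_distrib)
    also have "\<dots> \<le> B * \<zeta>" using b by (smt (verit) zero_le_power2 mult_nonneg_nonneg)
    finally have "(cmod (x $ 1 / y - z))\<^sup>2 \<le> M * \<zeta>" using xy(3) by (simp add: M_def field_simps)
    also have "\<dots> \<le> M\<^sup>2" using up \<zeta> by (simp add: power2_eq_square mult_left_mono)
    finally have "cmod (x $ 1 / y - z) \<le> M" by (rule power2_le_imp_le) (use up \<zeta> in linarith)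
    then show ?thesis using low up by (simp add: T_def wz dist_norm)
  qed
  have T3: "T \<subseteq> hyp3" using \<epsilon> by (auto simp: T_def hyp3_def)
  have T: "compact T" by (simp add: T_def compact_Times)
  \<comment> \<open>On \<open>T\<close> the distance functions are continuous, so the inequalities
    defining the two regions are closed conditions there.\<close>
  define R where "R = (\<Inter>t\<in>lattice0. {w \<in> T. vec_dist u w \<le> vec_dist t w} \<inter> {w \<in> T. vec_dist v w \<le> vec_dist t w})"
  have "S = T \<inter> R"
    using ST T3 unfolding R_def S_def vec_region_def by auto
  moreover have "closed {w \<in> T. vec_dist s w \<le> vec_dist t w}" if "s \<in> lattice0" "t \<in> lattice0" for s t
    using continuous_on_subset[OF continuous_on_vec_dist T3] compact_imp_closed[OF T] that
    by (intro continuous_on_closed_Collect_le) auto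
  then have "closed R"
    unfolding R_def using u v by (intro closed_INT ballI closed_Int) auto
  ultimately have "compact S" using compact_Int_closed[OF T] by simp
  then show ?thesis by (simp add: S_def)
qed

section \<open>Residues modulo an integer and discreteness of the order\<close>

definition coords :: "complex \<Rightarrow> int \<times> int" where
  "coords x = (SOME p. x = ring_elt (fst p) (snd p))"

lemma ring_elt_coords: "x \<in> A \<Longrightarrow> ring_elt (fst (coords x)) (snd (coords x)) = x"
  unfolding coords_def by (rule someI2_ex[of "\<lambda>p. x = ring_elt (fst p) (snd p)"]) (auto elim: A_E)

definition residue :: "int \<Rightarrow> complex \<Rightarrow> int \<times> int" where
  "residue n x = (fst (coords x) mod n, snd (coords x) mod n)"

lemma residue_eq_E:
  assumes "x \<in> A" "y \<in> A" "residue n x = residue n y"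
  obtains s where "s \<in> A" "y = x + of_int n * s"
proof -
  obtain p q where p: "x = ring_elt (fst p) (snd p)" "coords x = p" and q: "y = ring_elt (fst q) (snd q)" "coords y = q"
    using ring_elt_coords assms(1,2) by metis
  have "n dvd fst q - fst p" "n dvd snd q - snd p"
    using assms(3) p(2) q(2) by (auto simp: residue_def mod_eq_dvd_iff dvd_diff_commute)
  then obtain i j where "fst q = fst p + n * i" "snd q = snd p + n * j"
    by (metis dvd_def add.commute diff_add_cancel)
  then have "y = x + of_int n * ring_elt i j" by (simp add: p q ring_elt_def algebra_simps)
  then show thesis by (intro that[of "ring_elt i j"]) auto
qed

text \<open>The imaginary part bounds the coefficient of \<omega>, and then the real part bounds the
  other coefficient.\<close>

lemma finite_bounded_A: "finite {x \<in> A. cmod x \<le> B}"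
proof -
  define N where "N = B / Im \<omega>"
  define M where "M = B + N * \<bar>Re \<omega>\<bar>"
  have "{x \<in> A. cmod x \<le> B} \<subseteq> (\<lambda>(m, n). ring_elt m n) ` ({-\<lceil>M\<rceil>..\<lceil>M\<rceil>} \<times> {-\<lceil>N\<rceil>..\<lceil>N\<rceil>})"
  proof clarify
    fix x assume "x \<in> A" and B: "cmod x \<le> B"
    then obtain m n where x: "x = ring_elt m n" by (elim A_E)
    have "\<bar>Im x\<bar> \<le> B" using abs_Im_le_cmod B by (rule order_trans)
    then have n: "\<bar>real_of_int n\<bar> \<le> N"
      using Im_\<omega>_pos by (simp add: x ring_elt_def N_def abs_mult field_simps)
    have "\<bar>Re x\<bar> \<le> B" using abs_Re_le_cmod B by (rule order_trans)
    moreover have "real_of_int m = Re x - real_of_int n * Re \<omega>" by (simp add: x ring_elt_def)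
    ultimately have "\<bar>real_of_int m\<bar> \<le> B + \<bar>real_of_int n * Re \<omega>\<bar>" by linarith
    also have "\<dots> \<le> M" using n by (simp add: M_def abs_mult mult_right_mono)
    finally have m: "\<bar>real_of_int m\<bar> \<le> M" .
    have "\<bar>m\<bar> \<le> \<lceil>M\<rceil>" "\<bar>n\<bar> \<le> \<lceil>N\<rceil>" using m n by linarith+
    then show "x \<in> (\<lambda>(m, n). ring_elt m n) ` ({-\<lceil>M\<rceil>..\<lceil>M\<rceil>} \<times> {-\<lceil>N\<rceil>..\<lceil>N\<rceil>})"
      by (intro image_eqI[of _ _ "(m, n)"]) (auto simp: x)
  qed
  then show ?thesis by (rule finite_subset) simp
qed

end

section \<open>Values of an integral anisotropic form on lattice vectors\<close>

locale integral_anisotropic_form = imag_quadratic +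
  fixes f :: "complex^2 \<Rightarrow> real" and a c :: real and \<nu> :: complex
  assumes f_herm: "w \<in> quad_plane D \<Longrightarrow> complex_of_real (f w) = herm a c \<nu> w w"
    and integral: "integral_form D f"
    and anisotropic: "anisotropic_form D f"
begin

abbreviation "H \<equiv> herm a c \<nu>"

lemma int_lattice_subset_quad_plane: "u \<in> int_lattice D \<Longrightarrow> u \<in> quad_plane D"
  by (simp add: int_lattice_def quad_plane_def A_subset_quad_field)

lemma f_eq_H: "u \<in> int_lattice D \<Longrightarrow> complex_of_real (f u) = H u u"
  by (intro f_herm int_lattice_subset_quad_plane)

lemma f_in_Ints: "u \<in> int_lattice D \<Longrightarrow> f u \<in> \<int>"
  using integral by (auto simp: integral_form_def)

lemma f_abs_ge_1:
  assumes "u \<in> lattice0"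
  shows "\<bar>f u\<bar> \<ge> 1"
proof -
  have "f u \<noteq> 0"
    using assms anisotropic int_lattice_subset_quad_plane by (auto simp: anisotropic_form_def lattice0_def)
  moreover have "f u \<in> \<int>" using assms f_in_Ints by (simp add: lattice0_def)
  ultimately show ?thesis by (rule Ints_nonzero_abs_ge1[rotated])
qed

lemma int_lattice_combination:
  "u \<in> int_lattice D \<Longrightarrow> v \<in> int_lattice D \<Longrightarrow> x \<in> A \<Longrightarrow> x *s u + v \<in> int_lattice D"
  by (simp add: int_lattice_def)

lemma f_scale:
  assumes "u \<in> int_lattice D" "x \<in> A"
  shows "f (x *s u) = (cmod x)\<^sup>2 * f u"
proof -
  have "x *s u \<in> int_lattice D" using assms by (simp add: int_lattice_def)
  then have "complex_of_real (f (x *s u)) = H (x *s u) (x *s u)" by (rule f_eq_H)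
  also have "\<dots> = x * cnj x * H u u" by (simp add: herm_def algebra_simps)
  also have "\<dots> = complex_of_real ((cmod x)\<^sup>2 * f u)"
    by (simp add: complex_norm_square flip: f_eq_H[OF assms(1)] del: of_real_power)
  finally show ?thesis using of_real_eq_iff by blast
qed

lemma cusp_value_eq:
  assumes u: "u \<in> lattice0"
  shows "cusp_value D f (cusp_of u) = f u / content_norm u"
proof -
  define r where "r = cusp_rep D (cusp_of u)"
  have "cusp_of u \<in> cusps D" using u by (simp add: cusps_eq)
  from cusp_rep[OF this] have r: "r \<in> lattice0" "cusp_of r = cusp_of u"
    by (auto simp: r_def lattice0_def)
  have invariant: "f (x *s v) / content_norm (x *s v) = f v / content_norm v"
    if "v \<in> lattice0" "x \<in> A" "x \<noteq> 0" for x v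
    using that by (simp add: content_norm_scale f_scale lattice0_def)
  obtain x y where "x \<in> A" "y \<in> A" "x \<noteq> 0" "y \<noteq> 0" "x *s r = y *s u"
    using same_cusp_E[OF r(1) u r(2)] .
  then have "f r / content_norm r = f u / content_norm u"
    using invariant r u by metis
  then show ?thesis by (simp add: cusp_value_def cusp_ideal_norm_def content_norm_def r_def)
qed

text \<open>Polarization: the number is \<open>f (x *s u + v) - f (x *s u) - f v\<close>. Taking
  \<open>x\<close> to be 1 and \<omega> confines \<open>H u v\<close> to a discrete set.\<close>

lemma Re_H_in_Ints:
  assumes u: "u \<in> int_lattice D" and v: "v \<in> int_lattice D" and x: "x \<in> A"
  shows "2 * Re (x * H u v) \<in> \<int>"
proof -
  have uv: "x *s u + v \<in> int_lattice D" using assms by (rule int_lattice_combination)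
  have "complex_of_real (f (x *s u + v)) = H (x *s u + v) (x *s u + v)" using uv by (rule f_eq_H)
  also have "\<dots> = x * cnj x * H u u + x * H u v + cnj (x * H u v) + H v v"
    using herm_combination[of a c \<nu> x u 1 v] by (simp add: herm_sym[of a c \<nu> v u])
  also have "\<dots> = complex_of_real ((cmod x)\<^sup>2 * f u) + complex_of_real (f v) + (x * H u v + cnj (x * H u v))"
    by (simp add: complex_norm_square flip: f_eq_H[OF u] f_eq_H[OF v] del: of_real_power complex_cnj_mult)
  finally have "complex_of_real (f (x *s u + v))
      = complex_of_real ((cmod x)\<^sup>2 * f u + f v + 2 * Re (x * H u v))"
    by (simp only: complex_add_cnj of_real_add)
  then have "2 * Re (x * H u v) = f (x *s u + v) - f (x *s u) - f v"
    using f_scale[OF u x] of_real_eq_iff by (metis add_diff_cancel_left' diff_diff_add)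
  moreover have "f (x *s u + v) \<in> \<int>" "f (x *s u) \<in> \<int>" "f v \<in> \<int>"
    using uv u v x by (auto intro!: f_in_Ints simp: int_lattice_def)
  ultimately show ?thesis by simp
qed

text \<open>If \<open>f u\<close> and \<open>f v\<close> have opposite signs, the two terms of the
  Gram determinant are both non-positive, so there is no cancellation and the determinant controls
  each of them.\<close>

lemma f_product_bound:
  assumes u: "u \<in> int_lattice D" and v: "v \<in> int_lattice D" and neg: "f u * f v < 0"
  shows "\<bar>f u * f v\<bar> + (cmod (H u v))\<^sup>2
    = \<bar>a * c - (cmod \<nu>)\<^sup>2\<bar> * (cmod (u $ 1 * v $ 2 - v $ 1 * u $ 2))\<^sup>2"
proof -
  have "complex_of_real (f u * f v - (cmod (H u v))\<^sup>2)
      = H u u * H v v - H u v * H v u"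
    by (simp add: f_eq_H[OF u] f_eq_H[OF v] herm_sym[of a c \<nu> v u] complex_norm_square del: of_real_power)
  also have "\<dots> = complex_of_real ((a * c - (cmod \<nu>)\<^sup>2) * (cmod (u $ 1 * v $ 2 - v $ 1 * u $ 2))\<^sup>2)"
    unfolding herm_gram by (simp add: complex_norm_square mult.assoc del: of_real_power complex_cnj_diff complex_cnj_mult)
  finally have *: "f u * f v - (cmod (H u v))\<^sup>2
      = (a * c - (cmod \<nu>)\<^sup>2) * (cmod (u $ 1 * v $ 2 - v $ 1 * u $ 2))\<^sup>2"
    using of_real_eq_iff by blast
  have "\<bar>f u * f v\<bar> + (cmod (H u v))\<^sup>2 = \<bar>f u * f v - (cmod (H u v))\<^sup>2\<bar>"
    using neg zero_le_power2[of "cmod (H u v)"] by linarith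
  then show ?thesis unfolding * by (simp add: abs_mult)
qed

text \<open>
  If \<open>M = (u | v)\<close> and \<open>M' = (u' | v')\<close> have the same determinant \<open>\<delta>\<close> and agree modulo \<open>\<delta>\<close>,
  then \<open>M' M\<^sup>-\<^sup>1\<close> is integral; the entries of \<open>g\<close> below are those of this matrix.
\<close>

lemma unitary_transport:
  assumes u: "u \<in> int_lattice D" and v: "v \<in> int_lattice D"
    and s: "s \<in> int_lattice D" and t: "t \<in> int_lattice D"
    and \<delta>: "\<delta> = u $ 1 * v $ 2 - v $ 1 * u $ 2" "\<delta> \<noteq> 0"
    and u': "u' = u + \<delta> *s s" and v': "v' = v + \<delta> *s t"
    and \<delta>': "u' $ 1 * v' $ 2 - v' $ 1 * u' $ 2 = \<delta>"
    and gram: "H u' u' = H u u" "H v' v' = H v v" "H u' v' = H u v"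
  obtains g where "g \<in> unitary_group D f" "g *v u = u'" "g *v v = v'"
proof -
  \<comment> \<open>From \<open>M' = M + \<delta> (s | t)\<close> and
    \<open>M\<^sup>-\<^sup>1 = adj M / \<delta>\<close> one gets
    \<open>M' M\<^sup>-\<^sup>1 = 1 + (s | t) adj M\<close>, whose entries are visibly
    integral.\<close>
  define g :: "complex^2^2" where
    "g = vector [vector [1 + s $ 1 * v $ 2 - t $ 1 * u $ 2, t $ 1 * u $ 1 - s $ 1 * v $ 1],
                 vector [s $ 2 * v $ 2 - t $ 2 * u $ 2, 1 + t $ 2 * u $ 1 - s $ 2 * v $ 1]]"
  have gu: "g *v u = u'" and gv: "g *v v = v'"
    by (simp_all add: vec_eq_iff forall_2 matrix_vector_mult_def sum_2 g_def u' v' \<delta>(1) algebra_simps)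
  have "det g * \<delta> = (g *v u) $ 1 * (g *v v) $ 2 - (g *v v) $ 1 * (g *v u) $ 2"
    by (simp add: det_2 \<delta>(1) matrix_vector_mult_def sum_2 algebra_simps)
  then have det: "det g = 1" using \<delta>(2) by (simp add: gu gv \<delta>')
  define h :: "complex^2^2" where
    "h = vector [vector [g $ 2 $ 2, - g $ 1 $ 2], vector [- g $ 2 $ 1, g $ 1 $ 1]]"
  have g_int: "g \<in> int_matrices D"
    using u v s t by (simp add: int_matrices_def int_lattice_def forall_2 g_def)
  then have h_int: "h \<in> int_matrices D"
    by (simp add: int_matrices_def forall_2 h_def)
  have det': "g $ 1 $ 1 * g $ 2 $ 2 = 1 + g $ 1 $ 2 * g $ 2 $ 1" using det by (simp add: det_2 algebra_simps)
  have "g ** h = mat 1" "h ** g = mat 1"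
    using det' by (simp_all add: vec_eq_iff forall_2 matrix_matrix_mult_def sum_2 h_def mat_def algebra_simps)
  then have GL2: "g \<in> GL2 D" using g_int h_int by (auto simp: GL2_def)
  have "f (g *v w) = f w" if w: "w \<in> quad_plane D" for w
  proof -
    \<comment> \<open>Cramer's rule: the coordinates of \<open>w\<close> in the basis
      \<open>u\<close>, \<open>v\<close>. The image \<open>g *v w\<close> has the same coordinates
      in \<open>u'\<close>, \<open>v'\<close>, so equal Gram matrices give equal values.\<close>
    define p q where "p = (w $ 1 * v $ 2 - v $ 1 * w $ 2) / \<delta>" and "q = (u $ 1 * w $ 2 - w $ 1 * u $ 2) / \<delta>"
    have "\<delta> * p = w $ 1 * v $ 2 - v $ 1 * w $ 2" "\<delta> * q = u $ 1 * w $ 2 - w $ 1 * u $ 2"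
      using \<delta>(2) by (simp_all add: p_def q_def)
    then have "\<delta> * (p * u $ 1 + q * v $ 1) = \<delta> * w $ 1" "\<delta> * (p * u $ 2 + q * v $ 2) = \<delta> * w $ 2"
      by (simp_all add: distrib_left \<delta>(1) flip: mult.assoc) (simp_all add: algebra_simps)
    then have w_eq: "p *s u + q *s v = w" using \<delta>(2) by (simp add: vec_eq_iff forall_2)
    have gw: "g *v w = p *s u' + q *s v'"
      by (simp add: matrix_vector_right_distrib vector_scalar_commute gu gv flip: w_eq)
    have "complex_of_real (f (g *v w)) = H (g *v w) (g *v w)"
      by (rule f_herm) (rule int_matrix_quad_plane[OF g_int w])
    also have "\<dots> = H w w"
      using herm_combination[of a c \<nu> p u q v] herm_sym[of a c \<nu> v u]
      by (simp add: gw herm_combination gram herm_sym[of a c \<nu> v' u'] w_eq)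
    also have "\<dots> = complex_of_real (f w)" using f_herm[OF w] by simp
    finally show ?thesis using of_real_eq_iff by blast
  qed
  with GL2 have "g \<in> unitary_group D f" by (simp add: unitary_group_def)
  from this gu gv show thesis by (rule that)
qed

subsection \<open>Finiteness of the pairs of cusps up to the unitary group\<close>

text \<open>\<open>H u v\<close> is recorded by the traces of \<open>H u v\<close> and
  \<open>\<omega> * H u v\<close>: these are integers, and together they determine it.\<close>

definition gram :: "(complex^2) \<times> (complex^2) \<Rightarrow> real \<times> real \<times> real \<times> real" where
  "gram = (\<lambda>(u, v). (f u, f v, 2 * Re (H u v), 2 * Re (\<omega> * H u v)))"

text \<open>The modulus is the integer \<open>|\<delta>|^2\<close> for the minor
  \<open>\<delta>\<close>, so that residues can be read off from coordinates; congruence modulo it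
  implies congruence modulo \<open>\<delta>\<close>.\<close>

definition minor_residues :: "(complex^2) \<times> (complex^2) \<Rightarrow> (int \<times> int) \<times> (int \<times> int) \<times> (int \<times> int) \<times> (int \<times> int)" where
  "minor_residues = (\<lambda>(u, v). let n = \<lfloor>(cmod (minor (u, v)))\<^sup>2\<rfloor> in
     (residue n (u $ 1), residue n (u $ 2), residue n (v $ 1), residue n (v $ 2)))"

definition pair_invariant where
  "pair_invariant p = (gram p, minor p, minor_residues p)"

lemma minor_in_A: "u \<in> int_lattice D \<Longrightarrow> v \<in> int_lattice D \<Longrightarrow> minor (u, v) \<in> A"
  by (simp add: minor_def int_lattice_def)

lemma minor_nonzero:
  assumes "u \<in> int_lattice D" "v \<in> int_lattice D" "f u * f v < 0"
  shows "minor (u, v) \<noteq> 0"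
proof
  assume "minor (u, v) = 0"
  then have "\<bar>f u * f v\<bar> + (cmod (H u v))\<^sup>2 = 0" using f_product_bound[OF assms] by (simp add: minor_def)
  with assms(3) zero_le_power2[of "cmod (H u v)"] show False by linarith
qed

text \<open>\<open>f_product_bound\<close> bounds \<open>f u * f v\<close> and \<open>H u v\<close>.
  Both values of \<open>f\<close> are at least 1 in absolute value, so each is bounded separately,
  and integrality and discreteness leave finitely many possibilities.\<close>

lemma finite_pair_invariants:
  "finite (pair_invariant ` {(u, v). u \<in> lattice0 \<and> v \<in> lattice0 \<and> f u * f v < 0 \<and> (cmod (minor (u, v)))\<^sup>2 \<le> B})"
proof -
  define E where "E = \<bar>a * c - (cmod \<nu>)\<^sup>2\<bar> * B"
  \<comment> \<open>A common bound for all four Gram entries: \<open>1 + E\<close> bounds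
    \<open>cmod (H u v)\<close>, since its square is at most \<open>E\<close>, and
    \<open>1 + cmod \<omega>\<close> bounds both multipliers 1 and \<omega>.\<close>
  define N where "N = 2 * (1 + cmod \<omega>) * (1 + E)"
  define Z where "Z = {x::real. x \<in> \<int> \<and> \<bar>x\<bar> \<le> N}"
  define R where "R = {0..\<lfloor>B\<rfloor>} \<times> {0..\<lfloor>B\<rfloor>}"
  define T where "T = (Z \<times> Z \<times> Z \<times> Z) \<times> {x \<in> A. cmod x \<le> sqrt B} \<times> (R \<times> R \<times> R \<times> R)"
  have "finite T"
    using finite_abs_int_segment[of N] finite_bounded_A by (simp add: T_def Z_def R_def)
  moreover have "pair_invariant (u, v) \<in> T"
    if uv: "u \<in> lattice0" "v \<in> lattice0" and neg: "f u * f v < 0" and B: "(cmod (minor (u, v)))\<^sup>2 \<le> B" for u v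
  proof -
    have L: "u \<in> int_lattice D" "v \<in> int_lattice D" using uv by (auto simp: lattice0_def)
    have "\<bar>f u * f v\<bar> + (cmod (H u v))\<^sup>2 \<le> E"
      unfolding f_product_bound[OF L neg] E_def using B by (intro mult_left_mono) (auto simp: minor_def)
    then have E: "\<bar>f u\<bar> * \<bar>f v\<bar> \<le> E" "(cmod (H u v))\<^sup>2 \<le> E"
      using zero_le_power2[of "cmod (H u v)"] abs_ge_zero[of "f u * f v"] unfolding abs_mult by linarith+
    have E0: "E \<ge> 0" using E(2) zero_le_power2 order_trans by blast
    then have "0 \<le> cmod \<omega> * (1 + E)" by simp
    then have EN: "E \<le> N" using E0 by (simp add: N_def distrib_left distrib_right)
    have "\<bar>f u\<bar> \<le> \<bar>f u\<bar> * \<bar>f v\<bar>" "\<bar>f v\<bar> \<le> \<bar>f u\<bar> * \<bar>f v\<bar>"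
      using f_abs_ge_1[OF uv(1)] f_abs_ge_1[OF uv(2)]
      by (simp_all add: mult_le_cancel_left1 mult_le_cancel_right1)
    then have fZ: "f u \<in> Z" "f v \<in> Z" using E(1) EN f_in_Ints L by (auto simp: Z_def)
    have "cmod (H u v) \<le> 1 + E"
    proof (rule power2_le_imp_le)
      have "(cmod (H u v))\<^sup>2 \<le> E" by (rule E)
      also have "E \<le> (1 + E)\<^sup>2" using E0 by (simp add: power2_eq_square algebra_simps)
      finally show "(cmod (H u v))\<^sup>2 \<le> (1 + E)\<^sup>2" .
    qed (use E0 in simp)
    then have "\<bar>2 * Re (x * H u v)\<bar> \<le> N" if "cmod x \<le> 1 + cmod \<omega>" for x
    proof -
      have "\<bar>Re (x * H u v)\<bar> \<le> cmod x * cmod (H u v)" using abs_Re_le_cmod[of "x * H u v"] by (simp add: norm_mult)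
      also have "\<dots> \<le> (1 + cmod \<omega>) * (1 + E)"
        using that \<open>cmod (H u v) \<le> 1 + E\<close> by (intro mult_mono) auto
      finally show ?thesis
        unfolding N_def mult.assoc abs_mult by (simp only: abs_numeral mult_le_cancel_left_pos zero_less_numeral)
    qed
    then have "2 * Re (x * H u v) \<in> Z" if "cmod x \<le> 1 + cmod \<omega>" "x \<in> A" for x
      using that Re_H_in_Ints[OF L, of x] by (simp add: Z_def)
    from this[of 1] this[of \<omega>] fZ have 1: "gram (u, v) \<in> Z \<times> Z \<times> Z \<times> Z"
      by (simp add: gram_def)
    have 2: "minor (u, v) \<in> {x \<in> A. cmod x \<le> sqrt B}"
      using minor_in_A[OF L] B by (simp add: real_le_rsqrt)
    have "(cmod (minor (u, v)))\<^sup>2 \<ge> 1" using norm_ge_1[OF minor_in_A[OF L] minor_nonzero[OF L neg]] .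
    then have "0 < \<lfloor>(cmod (minor (u, v)))\<^sup>2\<rfloor>" "\<lfloor>(cmod (minor (u, v)))\<^sup>2\<rfloor> \<le> \<lfloor>B\<rfloor>"
      using B by (auto simp: floor_mono)
    then have "residue \<lfloor>(cmod (minor (u, v)))\<^sup>2\<rfloor> x \<in> R" for x
      by (auto simp: residue_def R_def intro: order_trans[OF less_imp_le[OF pos_mod_bound]])
    then have 3: "minor_residues (u, v) \<in> R \<times> R \<times> R \<times> R"
      by (simp add: minor_residues_def Let_def)
    from 1 2 3 show ?thesis by (simp add: pair_invariant_def T_def)
  qed
  ultimately show ?thesis by (auto intro: finite_subset[of _ T])
qed

text \<open>Equal residues modulo \<open>\<delta> * cnj \<delta>\<close> give differences of the
  form \<open>\<delta> *s s\<close>, with \<open>cnj \<delta>\<close> absorbed into the integral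
  vector \<open>s\<close>; this is the situation of \<open>unitary_transport\<close>.\<close>

lemma same_invariant_transport:
  assumes uv: "u \<in> int_lattice D" "v \<in> int_lattice D" and uv': "u' \<in> int_lattice D" "v' \<in> int_lattice D"
    and neg: "f u * f v < 0"
    and eq: "pair_invariant (u, v) = pair_invariant (u', v')"
  obtains g where "g \<in> unitary_group D f" "g *v u = u'" "g *v v = v'"
proof -
  define \<delta> where "\<delta> = minor (u, v)"
  define n where "n = \<lfloor>(cmod \<delta>)\<^sup>2\<rfloor>"
  have \<delta>0: "\<delta> \<noteq> 0" using minor_nonzero[OF uv neg] by (simp add: \<delta>_def)
  have \<delta>': "minor (u', v') = \<delta>" using eq by (simp add: pair_invariant_def \<delta>_def)
  have \<delta>A: "\<delta> \<in> A" using minor_in_A[OF uv] by (simp add: \<delta>_def)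
  obtain k where k: "(cmod \<delta>)\<^sup>2 = real k" "\<delta> * cnj \<delta> = of_nat k" using norm_in_Nats[OF \<delta>A] .
  have n: "of_int n = \<delta> * cnj \<delta>" by (simp add: n_def k)
  have res: "residue n (u $ i) = residue n (u' $ i)" "residue n (v $ i) = residue n (v' $ i)" for i
    using eq \<delta>' exhaust_2[of i]
    by (auto simp: pair_invariant_def minor_residues_def Let_def n_def \<delta>_def)
  have lift: "\<exists>s\<in>int_lattice D. y = x + \<delta> *s s"
    if x: "x \<in> int_lattice D" and y: "y \<in> int_lattice D" and "\<And>i. residue n (x $ i) = residue n (y $ i)" for x y
  proof -
    have "\<exists>s. s \<in> A \<and> y $ i = x $ i + of_int n * s" for i
      using residue_eq_E[of "x $ i" "y $ i" n] that by (metis int_lattice_def mem_Collect_eq)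
    then obtain s where s: "\<And>i. s i \<in> A" "\<And>i. y $ i = x $ i + of_int n * s i" by metis
    show ?thesis
    proof
      show "(\<chi> i. cnj \<delta> * s i) \<in> int_lattice D" using s \<delta>A by (simp add: int_lattice_def)
      show "y = x + \<delta> *s (\<chi> i. cnj \<delta> * s i)" using s n by (simp add: vec_eq_iff)
    qed
  qed
  obtain s where s: "s \<in> int_lattice D" "u' = u + \<delta> *s s" using lift[OF uv(1) uv'(1) res(1)] by blast
  obtain t where t: "t \<in> int_lattice D" "v' = v + \<delta> *s t" using lift[OF uv(2) uv'(2) res(2)] by blast
  have gram: "f u' = f u" "f v' = f v" "Re (H u' v') = Re (H u v)" "Re (\<omega> * H u' v') = Re (\<omega> * H u v)"
    using eq by (auto simp: pair_invariant_def gram_def)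
  \<comment> \<open>The real parts agree, so the equality of \<open>Re (\<omega> * H u v)\<close>
    and its primed version reduces to \<open>Im \<omega>\<close> times the imaginary parts.\<close>
  then have "Im (H u' v') = Im (H u v)" using Im_\<omega>_pos by simp
  with gram(3) have H_uv: "H u' v' = H u v" by (simp add: complex_eq_iff)
  have H_diag: "H u' u' = H u u" "H v' v' = H v v"
    using gram(1,2) f_eq_H uv uv' by metis+
  show thesis
  proof (rule unitary_transport[OF uv s(1) t(1) _ \<delta>0 s(2) t(2) _ H_diag H_uv])
    show "\<delta> = u $ 1 * v $ 2 - v $ 1 * u $ 2" by (simp add: \<delta>_def minor_def)
    show "u' $ 1 * v' $ 2 - v' $ 1 * u' $ 2 = \<delta>" using \<delta>' by (simp add: minor_def)
  qed (rule that)
qed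

text \<open>A compact set \<open>K\<close>, the union of one cell for each invariant that occurs,
  meets every orbit in the ocean. The quotient is therefore the continuous image of
  \<open>K\<close>.\<close>

theorem compact_ocean_quotient: "compact_space (ocean_quotient D f)"
proof -
  obtain m where m: "m > 0"
    "\<And>u. u \<in> lattice0 \<Longrightarrow> \<exists>v\<in>lattice0. cusp_of v = cusp_of u \<and> content_norm v \<le> m\<^sup>2"
    using reduced_representative by metis
  define cell where "cell = (\<lambda>(u, v). vec_region u \<inter> vec_region v)"
  \<comment> \<open>Bounded content makes the heights of \<open>u\<close> and \<open>v\<close>
    bounded on the cell. A non-empty cell provides a point at which Hadamard's inequality then
    bounds the minor by \<open>B\<close>.\<close>
  define P where "P = {(u, v). u \<in> lattice0 \<and> v \<in> lattice0 \<and> content_norm u \<le> m\<^sup>2 \<and> content_norm v \<le> m\<^sup>2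
    \<and> cusp_of u \<noteq> cusp_of v \<and> two_dimensional (cell (u, v)) \<and> f u * f v < 0 \<and> cell (u, v) \<noteq> {}}"
  define B where "B = (min_const * real (m\<^sup>2)) * (min_const * real (m\<^sup>2))"
  have spine: "spine_cell D (cusp_of u) (cusp_of v) = cell (u, v)" if "u \<in> lattice0" "v \<in> lattice0" for u v
    using that by (simp add: spine_cell_def cell_def cusp_region_eq)
  have cell_hyp3: "cell p \<subseteq> hyp3" for p by (auto simp: cell_def vec_region_def)
  have neg_iff: "cusp_value D f (cusp_of u) * cusp_value D f (cusp_of v) < 0 \<longleftrightarrow> f u * f v < 0"
    if "u \<in> lattice0" "v \<in> lattice0" for u v
    using that content_norm_pos[OF that(1)] content_norm_pos[OF that(2)]
    by (simp add: cusp_value_eq pos_divide_less_eq)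
  have "(cmod (minor (u, v)))\<^sup>2 \<le> B" if uv: "(u, v) \<in> P" for u v
  proof -
    obtain w where w: "w \<in> vec_region u" "w \<in> vec_region v" using uv by (auto simp: P_def cell_def)
    have w3: "w \<in> hyp3" using w by (simp add: vec_region_def)
    have ht: "height_form w x \<le> min_const * real (m\<^sup>2)"
      if "x \<in> lattice0" "w \<in> vec_region x" "content_norm x \<le> m\<^sup>2" for x
    proof -
      have "height_form w x \<le> min_const * real (content_norm x)" by (rule height_le_content) fact+
      also have "\<dots> \<le> min_const * real (m\<^sup>2)" using that min_const_pos by (intro mult_left_mono of_nat_mono) auto
      finally show ?thesis .
    qed
    have "(cmod (minor (u, v)))\<^sup>2 \<le> height_form w u * height_form w v"
      unfolding minor_def using det_le_height[OF w3] by simp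
    also have "\<dots> \<le> B"
      unfolding B_def using uv w height_form_nonneg[OF w3] min_const_pos
      by (intro mult_mono ht) (auto simp: P_def)
    finally show ?thesis .
  qed
  then have "P \<subseteq> {(u, v). u \<in> lattice0 \<and> v \<in> lattice0 \<and> f u * f v < 0 \<and> (cmod (minor (u, v)))\<^sup>2 \<le> B}"
    by (auto simp: P_def)
  then have "finite (pair_invariant ` P)"
    by (rule finite_subset[OF image_mono finite_pair_invariants])
  \<comment> \<open>One pair is kept for each of the finitely many invariants.\<close>
  then obtain R where R: "finite R" "R \<subseteq> P" "pair_invariant ` R = pair_invariant ` P"
    by (metis finite_subset_image order_refl)
  define K where "K = \<Union> (cell ` R)"
  have "compact (cell p)" if "p \<in> P" for p
  proof -
    obtain u v where p: "p = (u, v)" by (cases p)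
    have "minor (u, v) \<noteq> 0" using that by (intro minor_nonzero) (auto simp: P_def lattice0_def p)
    then show ?thesis using that unfolding p cell_def
      by (auto simp: P_def minor_def intro!: compact_vec_region_Int)
  qed
  then have "compact K" unfolding K_def using R(1,2) by (intro compact_UN) auto
  have "cell p \<subseteq> ocean D f" if "p \<in> P" for p
  proof -
    obtain u v where p: "p = (u, v)" by (cases p)
    have uv: "u \<in> lattice0" "v \<in> lattice0" "cusp_of u \<noteq> cusp_of v" "two_dimensional (cell (u, v))" "f u * f v < 0"
      using that by (auto simp: P_def p)
    then have "spine_cell D (cusp_of u) (cusp_of v) \<subseteq> ocean D f"
      unfolding ocean_def by (intro Union_upper CollectI exI[of _ "cusp_of u"] exI[of _ "cusp_of v"])
        (auto simp: cusps_eq spine neg_iff)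
    then show ?thesis by (simp add: spine uv p)
  qed
  then have K_ocean: "K \<subseteq> ocean D f" using R(2) by (auto simp: K_def)
  have "\<exists>w'\<in>K. unitary_orbit D f w = unitary_orbit D f w'" if w: "w \<in> ocean D f" for w
  proof -
    obtain \<alpha> \<beta> where \<alpha>\<beta>: "\<alpha> \<in> cusps D" "\<beta> \<in> cusps D" "\<alpha> \<noteq> \<beta>" "two_dimensional (spine_cell D \<alpha> \<beta>)"
      "cusp_value D f \<alpha> * cusp_value D f \<beta> < 0" "w \<in> spine_cell D \<alpha> \<beta>"
      using w unfolding ocean_def by blast
    obtain u where u: "u \<in> lattice0" "cusp_of u = \<alpha>" "content_norm u \<le> m\<^sup>2" using \<alpha>\<beta>(1) m(2) by (force simp: cusps_eq)
    obtain v where v: "v \<in> lattice0" "cusp_of v = \<beta>" "content_norm v \<le> m\<^sup>2" using \<alpha>\<beta>(2) m(2) by (force simp: cusps_eq)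
    have w_cell: "w \<in> cell (u, v)" using \<alpha>\<beta>(6) spine[OF u(1) v(1)] by (simp add: u v)
    have neg: "f u * f v < 0" using \<alpha>\<beta>(5) neg_iff[OF u(1) v(1)] by (simp add: u v)
    have "(u, v) \<in> P"
      using u v neg w_cell \<alpha>\<beta>(3,4) spine[OF u(1) v(1)] by (auto simp: P_def)
    \<comment> \<open>The chosen pair with the same invariant is the image of \<open>(u, v)\<close>
      under some \<open>g\<close> in the unitary group, and \<open>g\<close> carries
      \<open>w\<close> into the cell of that pair, hence into \<open>K\<close>.\<close>
    then obtain u' v' where R': "(u', v') \<in> R" "pair_invariant (u, v) = pair_invariant (u', v')"
      using R(3) by (metis (no_types, lifting) image_iff surj_pair)
    then have "(u', v') \<in> P" using R(2) by blast
    then have "u' \<in> int_lattice D" "v' \<in> int_lattice D" by (auto simp: P_def lattice0_def)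
    moreover have "u \<in> int_lattice D" "v \<in> int_lattice D" using u v by (auto simp: lattice0_def)
    ultimately obtain g where g: "g \<in> unitary_group D f" "g *v u = u'" "g *v v = v'"
      using same_invariant_transport[OF _ _ _ _ neg R'(2)] by blast
    have "g \<in> GL2 D" using g(1) by (simp add: unitary_group_def)
    then have "poincare_ext g w \<in> cell (u', v')"
      using w_cell vec_region_translate[of g w u] vec_region_translate[of g w v] by (simp add: cell_def g)
    then have "poincare_ext g w \<in> K" using R'(1) by (auto simp: K_def)
    moreover have "unitary_orbit D f w = unitary_orbit D f (poincare_ext g w)"
      using unitary_orbit_translate[OF g(1)] w_cell cell_hyp3 by blast
    ultimately show ?thesis by blast
  qed
  then have img: "unitary_orbit D f ` ocean D f = unitary_orbit D f ` K"
    using K_ocean by (auto simp: image_iff)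
  have quot: "quotient_map (top_of_set (ocean D f)) (ocean_quotient D f) (unitary_orbit D f)"
    unfolding ocean_quotient_def by (rule quotient_map_quotient_topology)
  have "compactin (top_of_set (ocean D f)) K"
    using \<open>compact K\<close> K_ocean by (simp add: compactin_subtopology)
  then have "compactin (ocean_quotient D f) (unitary_orbit D f ` K)"
    using image_compactin quotient_imp_continuous_map[OF quot] by blast
  moreover have "topspace (ocean_quotient D f) = unitary_orbit D f ` ocean D f"
    using quotient_imp_surjective_map[OF quot] by simp
  ultimately show ?thesis by (simp add: compact_space_def img)
qed

end

theorem theorem5p1:
  fixes D :: int and f :: "complex^2 \<Rightarrow> real"
  assumes "D < 0" and "fundamental_discriminant D"
    and "binary_hermitian_form D f"
    and "integral_form D f"
    and "indefinite_form D f"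
    and "anisotropic_form D f"
  shows "compact_space (ocean_quotient D f)"
proof -
  have "D mod 4 = 0 \<or> D mod 4 = 1"
    using assms(2) by (auto simp: fundamental_discriminant_def)
  moreover obtain a c :: rat and \<nu> where f: "\<forall>w\<in>quad_plane D. complex_of_real (f w)
      = of_rat a * of_real (cnorm2 (w $ 1)) + of_rat c * of_real (cnorm2 (w $ 2))
        + \<nu> * w $ 1 * cnj (w $ 2) + cnj \<nu> * cnj (w $ 1) * w $ 2"
    using assms(3) by (auto simp: binary_hermitian_form_def)
  \<comment> \<open>The rational coefficients are read as real ones, as the parameters of
    \<open>herm\<close> require.\<close>
  have of_rat: "(of_rat q :: complex) = of_real (of_rat q)" for q
    by (induction q) (simp add: of_rat_rat)
  have "complex_of_real (f w) = herm (of_rat a) (of_rat c) \<nu> w w" if "w \<in> quad_plane D" for w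
    using f that by (simp add: herm_def of_rat cnorm2_def complex_norm_square mult_ac del: of_real_power)
  ultimately interpret integral_anisotropic_form D f "of_rat a" "of_rat c" \<nu>
    using assms by unfold_locales auto
  show ?thesis by (rule compact_ocean_quotient)
qed

end
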